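(* Let $M=\{v_n\}_{n=1}^\infty$ be a countable set of distinct points, equipped with any one of the following metrics $\rho$, where the formulas are given for $n>k$: (a) $\rho(v_k,v_n)=k+n-\frac1k$; (b) $\rho(v_k,v_n)=2-\frac1k+\frac1n$; (c) $\rho(v_k,v_n)=2-\frac1k-\frac1{2n}$; (d) $\rho(v_k,v_n)=1+\frac1n$; (e) $\rho(v_k,v_n)=1+\frac1{2k}+\frac1n$. Then in each of the cases (a)--(e) the transportation cost space $\mathrm{TC}(M)$ does not contain an isometric copy of $\ell_1$ (that is, there is no linear isometric embedding of the real Banach space $\ell_1$ into $\mathrm{TC}(M)$).
   Context: Let $(M,d)$ be a metric space. $\mathrm{TP}(M)$ denotes the real vector space of finitely supported functions $f:M\to\mathbb{R}$ with $\sum_{v\in\operatorname{supp} f} f(v)=0$. For $u\in M$, $\mathbf{1}_u$ is the indicator function of $\{u\}$. A transportation plan for $f\in\mathrm{TP}(M)$ is a representation $f=\sum_{i=1}^n a_i(\mathbf{1}_{x_i}-\mathbf{1}_{y_i})$ with $a_i\ge 0$, $x_i,y_i\in M$; its cost is $\sum_{i=1}^n a_i d(x_i,y_i)$. The norm $\|f\|_{\mathrm{TC}}$ is the minimal cost over all transportation plans for $f$ (the minimum is attained). The transportation cost space $\mathrm{TC}(M)$ is the completion of the normed space $(\mathrm{TP}(M),\|\cdot\|_{\mathrm{TC}})$. In the claim, $\rho$ is symmetric with $\rho(v_n,v_n)=0$, and $d=\rho$. *)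

theory Defs
  imports "HOL-Analysis.Analysis"
begin

section \<open>The space \<open>TP(M)\<close> and the transportation cost norm\<close>

text \<open>The metric space \<open>M\<close> is rendered by a type of class \<^class>\<open>metric_space\<close>.\<close>

typedef 'a tp = "{f :: 'a \<Rightarrow> real. finite {v. f v \<noteq> 0} \<and> (\<Sum>v | f v \<noteq> 0. f v) = 0}"
  morphisms tp_apply Abs_tp
  by (rule exI[of _ "\<lambda>_. 0"]) simp

setup_lifting type_definition_tp

lemma sum_support_eq:
  fixes f :: "'a \<Rightarrow> real"
  assumes "finite S" "{v. f v \<noteq> 0} \<subseteq> S"
  shows "(\<Sum>v | f v \<noteq> 0. f v) = sum f S"
  by (rule sum.mono_neutral_left) (use assms in auto)

instantiation tp :: (type) real_vector
begin

lift_definition zero_tp :: "'a tp" is "\<lambda>_. 0" by simp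

lift_definition plus_tp :: "'a tp \<Rightarrow> 'a tp \<Rightarrow> 'a tp" is "\<lambda>f g v. f v + g v"
proof -
  fix f g :: "'a \<Rightarrow> real"
  assume f: "finite {v. f v \<noteq> 0} \<and> (\<Sum>v | f v \<noteq> 0. f v) = 0"
    and g: "finite {v. g v \<noteq> 0} \<and> (\<Sum>v | g v \<noteq> 0. g v) = 0"
  let ?S = "{v. f v \<noteq> 0} \<union> {v. g v \<noteq> 0}"
  have S: "finite ?S" using f g by simp
  have sub: "{v. f v + g v \<noteq> 0} \<subseteq> ?S" by auto
  have "(\<Sum>v | f v + g v \<noteq> 0. f v + g v) = (\<Sum>v\<in>?S. f v + g v)"
    using sum_support_eq[OF S sub] .
  also have "\<dots> = sum f ?S + sum g ?S" by (rule sum.distrib)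
  also have "sum f ?S = 0" using sum_support_eq[OF S, of f] f by auto
  also have "sum g ?S = 0" using sum_support_eq[OF S, of g] g by auto
  finally show "finite {v. f v + g v \<noteq> 0} \<and> (\<Sum>v | f v + g v \<noteq> 0. f v + g v) = 0"
    using finite_subset[OF sub S] by simp
qed

lift_definition scaleR_tp :: "real \<Rightarrow> 'a tp \<Rightarrow> 'a tp" is "\<lambda>c f v. c * f v"
proof -
  fix c :: real and f :: "'a \<Rightarrow> real"
  assume f: "finite {v. f v \<noteq> 0} \<and> (\<Sum>v | f v \<noteq> 0. f v) = 0"
  have "(\<Sum>v | c * f v \<noteq> 0. c * f v) = (\<Sum>v | f v \<noteq> 0. c * f v)"
    by (rule sum_support_eq) (use f in auto)
  also have "\<dots> = 0" using f by (simp add: sum_distrib_left[symmetric])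
  finally show "finite {v. c * f v \<noteq> 0} \<and> (\<Sum>v | c * f v \<noteq> 0. c * f v) = 0"
    using f by (auto elim: rev_finite_subset)
qed

definition uminus_tp :: "'a tp \<Rightarrow> 'a tp" where "uminus_tp f = (-1) *\<^sub>R f"

definition minus_tp :: "'a tp \<Rightarrow> 'a tp \<Rightarrow> 'a tp" where "minus_tp f g = f + (- g)"

instance
  by standard (unfold uminus_tp_def minus_tp_def, (transfer, simp add: algebra_simps fun_eq_iff)+)

end

lemma tp_apply_simps [simp]:
  "tp_apply 0 v = 0"
  "tp_apply (f + g) v = tp_apply f v + tp_apply g v"
  "tp_apply (c *\<^sub>R f) v = c * tp_apply f v"
  "tp_apply (- f) v = - tp_apply f v"
  "tp_apply (f - g) v = tp_apply f v - tp_apply g v"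
  unfolding minus_tp_def uminus_tp_def by (transfer, simp)+

lemma tp_eqI: "(\<And>v. tp_apply f v = tp_apply g v) \<Longrightarrow> f = g"
  by transfer auto

lemma finite_tp_support: "finite {v. tp_apply f v \<noteq> 0}"
  using tp_apply[of f] by simp

lemma sum_tp_support: "(\<Sum>v | tp_apply f v \<noteq> 0. tp_apply f v) = 0"
  using tp_apply[of f] by simp

text \<open>The triple \<open>(a, x, y)\<close> in a transportation plan stands for the summand
  \<open>a (1\<^sub>x - 1\<^sub>y)\<close>.\<close>

definition transport_plan :: "'a tp \<Rightarrow> (real \<times> 'a \<times> 'a) list \<Rightarrow> bool" where
  "transport_plan f p \<longleftrightarrow>
     (\<forall>(a, x, y) \<in> set p. 0 \<le> a) \<and>
     (\<forall>v. tp_apply f v = (\<Sum>(a, x, y)\<leftarrow>p. a * (indicator {x} v - indicator {y} v)))"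

definition plan_cost :: "(real \<times> 'a::metric_space \<times> 'a) list \<Rightarrow> real" where
  "plan_cost p = (\<Sum>(a, x, y)\<leftarrow>p. a * dist x y)"

lemma plan_cost_nonneg: "transport_plan f p \<Longrightarrow> 0 \<le> plan_cost p"
  unfolding plan_cost_def transport_plan_def by (rule sum_list_nonneg) auto

lemma plan_exists: "\<exists>p. transport_plan f p"
proof -
  obtain vs where vs: "set vs = {v. tp_apply f v \<noteq> 0}" "distinct vs"
    using finite_distinct_list[OF finite_tp_support[of f]] by auto
  define e :: 'a where "e = undefined"
  define p where "p = map (\<lambda>u. if 0 \<le> tp_apply f u then (tp_apply f u, u, e)
                                else (- tp_apply f u, e, u)) vs"
  have "(\<Sum>(a, x, y)\<leftarrow>p. a * (indicator {x} v - indicator {y} v)) = tp_apply f v" for v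
  proof -
    have "(\<Sum>(a, x, y)\<leftarrow>p. a * (indicator {x} v - indicator {y} v))
        = (\<Sum>u\<leftarrow>vs. tp_apply f u * (indicator {u} v - indicator {e} v))"
      unfolding p_def map_map o_def by (intro arg_cong[of _ _ sum_list] map_cong) (auto simp: algebra_simps)
    also have "\<dots> = (\<Sum>u | tp_apply f u \<noteq> 0. tp_apply f u * (indicator {u} v - indicator {e} v))"
      using vs by (simp add: sum_list_distinct_conv_sum_set)
    also have "\<dots> = (\<Sum>u | tp_apply f u \<noteq> 0. tp_apply f u * indicator {u} v)
                  - (\<Sum>u | tp_apply f u \<noteq> 0. tp_apply f u) * indicator {e} v"
      by (simp add: right_diff_distrib sum_subtractf sum_distrib_right)
    also have "\<dots> = (\<Sum>u | tp_apply f u \<noteq> 0. if v = u then tp_apply f u else 0)"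
      by (auto simp: sum_tp_support indicator_def intro!: sum.cong)
    also have "\<dots> = tp_apply f v"
      by (subst sum.delta') (auto simp: finite_tp_support)
    finally show ?thesis .
  qed
  moreover have "\<forall>(a, x, y) \<in> set p. 0 \<le> a" unfolding p_def by auto
  ultimately show ?thesis unfolding transport_plan_def by metis
qed

lemma transport_plan_append:
  "transport_plan f p \<Longrightarrow> transport_plan g q \<Longrightarrow> transport_plan (f + g) (p @ q)"
  unfolding transport_plan_def by auto

lemma plan_cost_append: "plan_cost (p @ q) = plan_cost p + plan_cost q"
  by (simp add: plan_cost_def)

lemma plan_scale:
  assumes "transport_plan f p"
  shows "\<exists>q. transport_plan (c *\<^sub>R f) q \<and> plan_cost q = \<bar>c\<bar> * plan_cost p"
proof -
  define q where "q = map (\<lambda>(a, x, y). if 0 \<le> c then (c * a, x, y) else (- c * a, y, x)) p"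
  have "(\<Sum>(a, x, y)\<leftarrow>q. a * (indicator {x} v - indicator {y} v))
      = c * (\<Sum>(a, x, y)\<leftarrow>p. a * (indicator {x} v - indicator {y} v))" for v
    unfolding q_def by (induction p) (auto simp: algebra_simps)
  moreover have "\<forall>(a, x, y) \<in> set q. 0 \<le> a"
    using assms unfolding q_def transport_plan_def
    by (auto simp: case_prod_beta mult_nonpos_nonneg split: if_splits)
  moreover have "plan_cost q = \<bar>c\<bar> * plan_cost p"
    unfolding q_def plan_cost_def by (induction p) (auto simp: algebra_simps dist_commute)
  ultimately show ?thesis using assms unfolding transport_plan_def by auto
qed

lemma plan_pairing:
  fixes g :: "'a::metric_space \<Rightarrow> real"
  assumes p: "transport_plan f p" and g: "\<And>x y. \<bar>g x - g y\<bar> \<le> dist x y"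
  shows "(\<Sum>v | tp_apply f v \<noteq> 0. tp_apply f v * g v) \<le> plan_cost p"
proof -
  define S where "S = {v. tp_apply f v \<noteq> 0} \<union> (fst \<circ> snd) ` set p \<union> (snd \<circ> snd) ` set p"
  have fin: "finite S" unfolding S_def using finite_tp_support by auto
  have "(\<Sum>v | tp_apply f v \<noteq> 0. tp_apply f v * g v) = (\<Sum>v\<in>S. tp_apply f v * g v)"
    by (rule sum.mono_neutral_left) (use fin S_def in auto)
  also have "\<dots> = (\<Sum>v\<in>S. (\<Sum>(a, x, y)\<leftarrow>p. a * (indicator {x} v - indicator {y} v)) * g v)"
    using p unfolding transport_plan_def by (metis (no_types, lifting))
  also have "\<dots> = (\<Sum>(a, x, y)\<leftarrow>p. a * (g x - g y))"
  proof -
    have "\<And>q. set q \<subseteq> set p \<Longrightarrow>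
      (\<Sum>v\<in>S. (\<Sum>(a, x, y)\<leftarrow>q. a * (indicator {x} v - indicator {y} v)) * g v)
      = (\<Sum>(a, x, y)\<leftarrow>q. a * (g x - g y))"
    proof -
      fix q show "set q \<subseteq> set p \<Longrightarrow>
      (\<Sum>v\<in>S. (\<Sum>(a, x, y)\<leftarrow>q. a * (indicator {x} v - indicator {y} v)) * g v)
      = (\<Sum>(a, x, y)\<leftarrow>q. a * (g x - g y))"
      proof (induction q)
        case Nil then show ?case by simp
      next
        case (Cons t q)
        obtain a x y where t: "t = (a, x, y)" by (cases t)
        have "x \<in> S" "y \<in> S" using Cons.prems unfolding S_def t by force+
        then have *: "(\<Sum>v\<in>S. indicator {x} v * g v) = g x" "(\<Sum>v\<in>S. indicator {y} v * g v) = g y"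
          using fin by (simp_all add: indicator_def if_distrib[of "\<lambda>z. z * _"] sum.delta cong: if_cong)
        have "(\<Sum>v\<in>S. (a * (indicator {x} v - indicator {y} v)) * g v)
            = a * ((\<Sum>v\<in>S. indicator {x} v * g v) - (\<Sum>v\<in>S. indicator {y} v * g v))"
          by (simp add: sum_distrib_left sum_subtractf[symmetric] algebra_simps)
        then show ?case using Cons * by (simp add: t distrib_right sum.distrib)
      qed
    qed
    then show ?thesis by blast
  qed
  also have "\<dots> \<le> plan_cost p"
    unfolding plan_cost_def
    using p unfolding transport_plan_def
    by (intro sum_list_mono) (auto intro!: mult_left_mono order_trans[OF abs_ge_self g])
  finally show ?thesis .
qed

instantiation tp :: (metric_space) real_normed_vector
begin

text \<open>The infimum is taken over a nonempty set of nonnegative reals (\<open>plan_exists\<close>,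
  \<open>plan_cost_nonneg\<close>); it equals the minimal cost, as the minimum is attained.\<close>

definition norm_tp :: "'a tp \<Rightarrow> real" where
  "norm_tp f = Inf {plan_cost p | p. transport_plan f p}"

definition dist_tp :: "'a tp \<Rightarrow> 'a tp \<Rightarrow> real" where "dist_tp f g = norm (f - g)"

definition sgn_tp :: "'a tp \<Rightarrow> 'a tp" where "sgn_tp f = f /\<^sub>R norm f"

definition uniformity_tp :: "('a tp \<times> 'a tp) filter" where
  "uniformity_tp = (INF e\<in>{0 <..}. principal {(f, g). dist f g < e})"

definition open_tp :: "'a tp set \<Rightarrow> bool" where
  "open_tp S = (\<forall>f\<in>S. \<forall>\<^sub>F (f', g) in uniformity. f' = f \<longrightarrow> g \<in> S)"

instance
proof
  fix f g :: "'a tp" and c :: real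
  have le: "norm h \<le> plan_cost p" if "transport_plan h p" for h :: "'a tp" and p
    unfolding norm_tp_def
    by (rule cInf_lower) (use that plan_cost_nonneg in \<open>auto intro!: bdd_belowI[of _ 0]\<close>)
  have ge: "b \<le> norm h" if "\<And>p. transport_plan h p \<Longrightarrow> b \<le> plan_cost p" for h :: "'a tp" and b
    unfolding norm_tp_def by (rule cInf_greatest) (use that plan_exists in auto)
  show "dist f g = norm (f - g)" by (rule dist_tp_def)
  show "sgn f = f /\<^sub>R norm f" by (rule sgn_tp_def)
  show "uniformity = (INF e\<in>{0 <..}. principal {(f, g :: 'a tp). dist f g < e})"
    by (rule uniformity_tp_def)
  show "open U = (\<forall>f\<in>U. \<forall>\<^sub>F (f', g) in uniformity. f' = f \<longrightarrow> g \<in> U)" for U :: "'a tp set"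
    by (rule open_tp_def)
  show "norm (f + g) \<le> norm f + norm g"
  proof -
    have "norm (f + g) - plan_cost q \<le> norm f" if q: "transport_plan g q" for q
    proof (rule ge)
      fix p assume "transport_plan f p"
      from le[OF transport_plan_append[OF this q]]
      show "norm (f + g) - plan_cost q \<le> plan_cost p" by (simp add: plan_cost_append)
    qed
    then have "norm (f + g) - norm f \<le> norm g" by (intro ge) (simp add: algebra_simps)
    then show ?thesis by simp
  qed
  have scale_le: "norm (c *\<^sub>R h) \<le> \<bar>c\<bar> * norm h" for c and h :: "'a tp"
  proof (cases "c = 0")
    case True
    have "transport_plan (0::'a tp) []" by (simp add: transport_plan_def)
    from le[OF this] show ?thesis using True by (simp add: plan_cost_def)
  next
    case False
    have "norm (c *\<^sub>R h) / \<bar>c\<bar> \<le> norm h"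
    proof (rule ge)
      fix p assume "transport_plan h p"
      then obtain q where "transport_plan (c *\<^sub>R h) q" "plan_cost q = \<bar>c\<bar> * plan_cost p"
        using plan_scale by blast
      then show "norm (c *\<^sub>R h) / \<bar>c\<bar> \<le> plan_cost p"
        using le[of "c *\<^sub>R h" q] False by (simp add: divide_simps mult.commute)
    qed
    then show ?thesis using False by (simp add: divide_simps mult.commute)
  qed
  show "norm (c *\<^sub>R f) = \<bar>c\<bar> * norm f"
  proof (cases "c = 0")
    case True
    have "0 \<le> norm (0::'a tp)" by (rule ge) (rule plan_cost_nonneg)
    then show ?thesis using scale_le[of 0 f] True by simp
  next
    case False
    then have "norm f \<le> \<bar>inverse c\<bar> * norm (c *\<^sub>R f)"
      using scale_le[of "inverse c" "c *\<^sub>R f"] by simp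
    then have "\<bar>c\<bar> * norm f \<le> norm (c *\<^sub>R f)"
      using False by (simp add: divide_simps mult.commute)
    then show ?thesis using scale_le[of c f] by simp
  qed
  show "(norm f = 0) = (f = 0)"
  proof
    assume "f = 0"
    have "transport_plan (0::'a tp) []" by (simp add: transport_plan_def)
    from le[OF this] have "norm (0::'a tp) \<le> 0" by (simp add: plan_cost_def)
    moreover have "0 \<le> norm (0::'a tp)" by (rule ge) (rule plan_cost_nonneg)
    ultimately show "norm f = 0" using \<open>f = 0\<close> by simp
  next
    assume n: "norm f = 0"
    show "f = 0"
    proof (rule ccontr)
      assume "f \<noteq> 0"
      then obtain u where u: "tp_apply f u \<noteq> 0" using tp_eqI[of f 0] by auto
      let ?s = "sgn (tp_apply f u)"
      define D where "D = insert 1 (dist u ` ({v. tp_apply f v \<noteq> 0} - {u}))"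
      define \<delta> where "\<delta> = Min D"
      have fin: "finite D" "D \<noteq> {}" unfolding D_def using finite_tp_support by auto
      have \<delta>: "\<delta> > 0" unfolding \<delta>_def using fin by (subst Min_gr_iff) (auto simp: D_def)
      have \<delta>_le: "\<delta> \<le> dist u v" if "tp_apply f v \<noteq> 0" "v \<noteq> u" for v
        unfolding \<delta>_def by (rule Min_le) (use that fin in \<open>auto simp: D_def\<close>)
      define g where "g v = ?s * max 0 (\<delta> - dist u v)" for v
      have s: "\<bar>?s\<bar> = 1" using u by (simp add: abs_sgn_eq)
      have g: "\<bar>g x - g y\<bar> \<le> dist x y" for x y
      proof -
        have "\<bar>g x - g y\<bar> = \<bar>max 0 (\<delta> - dist u x) - max 0 (\<delta> - dist u y)\<bar>"
          unfolding g_def right_diff_distrib[symmetric] abs_mult s by simp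
        also have "\<dots> \<le> dist x y"
          using dist_triangle[of u x y] dist_triangle[of u y x] dist_commute[of x y] by linarith
        finally show ?thesis .
      qed
      have "(\<Sum>v | tp_apply f v \<noteq> 0. tp_apply f v * g v)
          = (\<Sum>v | tp_apply f v \<noteq> 0. if v = u then \<bar>tp_apply f u\<bar> * \<delta> else 0)"
        using \<delta> \<delta>_le by (intro sum.cong) (force simp: g_def max_def abs_sgn)+
      also have "\<dots> = \<bar>tp_apply f u\<bar> * \<delta>"
        using u by (simp add: sum.delta finite_tp_support)
      finally have "\<bar>tp_apply f u\<bar> * \<delta> \<le> norm f"
        using plan_pairing[OF _ g] by (intro ge) metis
      then show False using n u \<delta> by (simp add: mult_le_0_iff)
    qed
  qed
qed

end


section \<open>The completion of a normed space\<close>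

text \<open>Cauchy sequences modulo null sequences.\<close>

definition cauchy_rel :: "(nat \<Rightarrow> 'a::real_normed_vector) \<Rightarrow> (nat \<Rightarrow> 'a) \<Rightarrow> bool" where
  "cauchy_rel X Y \<longleftrightarrow> Cauchy X \<and> Cauchy Y \<and> (\<lambda>n. X n - Y n) \<longlonglongrightarrow> 0"

lemma part_equivp_cauchy_rel: "part_equivp (cauchy_rel :: (nat \<Rightarrow> 'a::real_normed_vector) \<Rightarrow> _)"
proof (rule part_equivpI)
  show "\<exists>X :: nat \<Rightarrow> 'a. cauchy_rel X X"
    by (rule exI[of _ "\<lambda>_. 0"]) (simp add: cauchy_rel_def Cauchy_def)
  show "symp (cauchy_rel :: (nat \<Rightarrow> 'a) \<Rightarrow> _)"
  proof (rule sympI)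
    fix X Y :: "nat \<Rightarrow> 'a" assume "cauchy_rel X Y"
    then show "cauchy_rel Y X"
      using tendsto_minus[of "\<lambda>n. X n - Y n" 0 sequentially] by (simp add: cauchy_rel_def)
  qed
  show "transp (cauchy_rel :: (nat \<Rightarrow> 'a) \<Rightarrow> _)"
  proof (rule transpI)
    fix X Y Z :: "nat \<Rightarrow> 'a" assume "cauchy_rel X Y" "cauchy_rel Y Z"
    then show "cauchy_rel X Z"
      using tendsto_add[of "\<lambda>n. X n - Y n" 0 sequentially "\<lambda>n. Y n - Z n" 0]
      by (simp add: cauchy_rel_def)
  qed
qed

quotient_type (overloaded) 'a completion = "nat \<Rightarrow> 'a::real_normed_vector" / partial: cauchy_rel
  by (rule part_equivp_cauchy_rel)

lemma Cauchy_add: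
  fixes X Y :: "nat \<Rightarrow> 'a::real_normed_vector"
  assumes X: "Cauchy X" and Y: "Cauchy Y"
  shows "Cauchy (\<lambda>n. X n + Y n)"
proof (rule metric_CauchyI)
  fix e :: real assume "e > 0"
  then obtain M N where M: "\<And>m n. m \<ge> M \<Longrightarrow> n \<ge> M \<Longrightarrow> dist (X m) (X n) < e / 2"
    and N: "\<And>m n. m \<ge> N \<Longrightarrow> n \<ge> N \<Longrightarrow> dist (Y m) (Y n) < e / 2"
    using metric_CauchyD[OF X, of "e / 2"] metric_CauchyD[OF Y, of "e / 2"] half_gt_zero by metis
  have "dist (X m + Y m) (X n + Y n) < e" if "m \<ge> max M N" "n \<ge> max M N" for m n
    using dist_triangle_add[of "X m" "Y m" "X n" "Y n"] M[of m n] N[of m n] that by simp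
  then show "\<exists>K. \<forall>m\<ge>K. \<forall>n\<ge>K. dist (X m + Y m) (X n + Y n) < e" by blast
qed

lemma Cauchy_scaleR:
  fixes X :: "nat \<Rightarrow> 'a::real_normed_vector"
  shows "Cauchy X \<Longrightarrow> Cauchy (\<lambda>n. c *\<^sub>R X n)"
  by (rule bounded_linear.Cauchy[OF bounded_linear_scaleR_right])

lemma Cauchy_diff:
  fixes X Y :: "nat \<Rightarrow> 'a::real_normed_vector"
  shows "Cauchy X \<Longrightarrow> Cauchy Y \<Longrightarrow> Cauchy (\<lambda>n. X n - Y n)"
  using Cauchy_add[of X "\<lambda>n. (-1) *\<^sub>R Y n"] Cauchy_scaleR[of Y "-1"] by simp

lemma Cauchy_norm:
  fixes X :: "nat \<Rightarrow> 'a::real_normed_vector"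
  assumes "Cauchy X"
  shows "convergent (\<lambda>n. norm (X n))"
proof -
  have "Cauchy (\<lambda>n. norm (X n))"
  proof (rule metric_CauchyI)
    fix e :: real assume "e > 0"
    then obtain N where N: "\<And>m n. m \<ge> N \<Longrightarrow> n \<ge> N \<Longrightarrow> dist (X m) (X n) < e"
      using assms by (meson metric_CauchyD)
    have "dist (norm (X m)) (norm (X n)) \<le> dist (X m) (X n)" for m n
      using norm_triangle_ineq3[of "X m" "X n"] by (simp add: dist_norm)
    then show "\<exists>N. \<forall>m\<ge>N. \<forall>n\<ge>N. dist (norm (X m)) (norm (X n)) < e"
      using N by (meson le_less_trans)
  qed
  then show ?thesis by (simp add: Cauchy_convergent_iff)
qed

instantiation completion :: (real_normed_vector) real_vector
begin

lift_definition zero_completion :: "'a completion" is "\<lambda>_. 0"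
  by (simp add: cauchy_rel_def Cauchy_def)

lift_definition plus_completion :: "'a completion \<Rightarrow> 'a completion \<Rightarrow> 'a completion"
  is "\<lambda>X Y n. X n + Y n"
proof -
  fix X X' Y Y' :: "nat \<Rightarrow> 'a"
  assume "cauchy_rel X X'" "cauchy_rel Y Y'"
  then show "cauchy_rel (\<lambda>n. X n + Y n) (\<lambda>n. X' n + Y' n)"
    unfolding cauchy_rel_def
    using tendsto_add[of "\<lambda>n. X n - X' n" 0 sequentially "\<lambda>n. Y n - Y' n" 0]
    by (auto intro: Cauchy_add simp: algebra_simps)
qed

lift_definition scaleR_completion :: "real \<Rightarrow> 'a completion \<Rightarrow> 'a completion"
  is "\<lambda>c X n. c *\<^sub>R X n"
proof -
  fix c :: real and X Y :: "nat \<Rightarrow> 'a"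
  assume "cauchy_rel X Y"
  then show "cauchy_rel (\<lambda>n. c *\<^sub>R X n) (\<lambda>n. c *\<^sub>R Y n)"
    unfolding cauchy_rel_def
    using tendsto_scaleR[OF tendsto_const, of "\<lambda>n. X n - Y n" 0 sequentially c]
    by (auto intro: Cauchy_scaleR simp: scaleR_diff_right)
qed

definition uminus_completion :: "'a completion \<Rightarrow> 'a completion" where
  "uminus_completion x = (-1) *\<^sub>R x"

definition minus_completion :: "'a completion \<Rightarrow> 'a completion \<Rightarrow> 'a completion" where
  "minus_completion x y = x + (- y)"

instance
proof
  fix x y z :: "'a completion" and a b :: real
  have C0: "Cauchy (\<lambda>n. 0 :: 'a)" by (simp add: Cauchy_def)
  show "x + y + z = x + (y + z)"
    by transfer (auto simp: cauchy_rel_def add.assoc intro!: Cauchy_add)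
  show "x + y = y + x"
    by transfer (auto simp: cauchy_rel_def add.commute intro!: Cauchy_add)
  show "0 + x = x"
    by transfer (auto simp: cauchy_rel_def)
  show "- x + x = 0"
    unfolding uminus_completion_def
    by transfer (auto simp: cauchy_rel_def C0)
  show "x - y = x + - y" by (rule minus_completion_def)
  show "a *\<^sub>R (x + y) = a *\<^sub>R x + a *\<^sub>R y"
    by transfer (auto simp: cauchy_rel_def scaleR_add_right intro!: Cauchy_add Cauchy_scaleR)
  show "(a + b) *\<^sub>R x = a *\<^sub>R x + b *\<^sub>R x"
    by transfer (auto simp: cauchy_rel_def scaleR_add_left intro!: Cauchy_add Cauchy_scaleR)
  show "a *\<^sub>R b *\<^sub>R x = (a * b) *\<^sub>R x"
    by transfer (auto simp: cauchy_rel_def intro!: Cauchy_scaleR)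
  show "1 *\<^sub>R x = x"
    by transfer (auto simp: cauchy_rel_def)
qed

end

instantiation completion :: (real_normed_vector) real_normed_vector
begin

lift_definition norm_completion :: "'a completion \<Rightarrow> real" is "\<lambda>X. lim (\<lambda>n. norm (X n))"
proof -
  fix X Y :: "nat \<Rightarrow> 'a"
  assume XY: "cauchy_rel X Y"
  obtain l where l: "(\<lambda>n. norm (Y n)) \<longlonglongrightarrow> l"
    using XY Cauchy_norm unfolding cauchy_rel_def convergent_def by blast
  have "(\<lambda>n. norm (X n - Y n)) \<longlonglongrightarrow> 0"
    using XY unfolding cauchy_rel_def by (simp add: tendsto_norm_zero)
  then have "(\<lambda>n. norm (X n) - norm (Y n)) \<longlonglongrightarrow> 0"
    by (rule Lim_null_comparison[rotated]) (simp add: norm_triangle_ineq3)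
  from tendsto_add[OF this l] have "(\<lambda>n. norm (X n)) \<longlonglongrightarrow> l" by simp
  then show "lim (\<lambda>n. norm (X n)) = lim (\<lambda>n. norm (Y n))" using l by (simp add: limI)
qed

definition dist_completion :: "'a completion \<Rightarrow> 'a completion \<Rightarrow> real" where
  "dist_completion x y = norm (x - y)"

definition sgn_completion :: "'a completion \<Rightarrow> 'a completion" where
  "sgn_completion x = x /\<^sub>R norm x"

definition uniformity_completion :: "('a completion \<times> 'a completion) filter" where
  "uniformity_completion = (INF e\<in>{0 <..}. principal {(x, y). dist x y < e})"

definition open_completion :: "'a completion set \<Rightarrow> bool" where
  "open_completion S = (\<forall>x\<in>S. \<forall>\<^sub>F (x', y) in uniformity. x' = x \<longrightarrow> y \<in> S)"

instance
proof
  fix x y :: "'a completion" and a :: real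
  have lim: "(\<lambda>n. norm (X n)) \<longlonglongrightarrow> lim (\<lambda>n. norm (X n))" if "Cauchy X" for X :: "nat \<Rightarrow> 'a"
    using Cauchy_norm[OF that] by (simp add: convergent_LIMSEQ_iff)
  have refl: "cauchy_rel X X \<longleftrightarrow> Cauchy X" for X :: "nat \<Rightarrow> 'a"
    by (simp add: cauchy_rel_def)
  have C0: "Cauchy (\<lambda>n. 0 :: 'a)" by (simp add: Cauchy_def)
  show "dist x y = norm (x - y)" by (rule dist_completion_def)
  show "sgn x = x /\<^sub>R norm x" by (rule sgn_completion_def)
  show "uniformity = (INF e\<in>{0 <..}. principal {(x, y :: 'a completion). dist x y < e})"
    by (rule uniformity_completion_def)
  show "open U = (\<forall>x\<in>U. \<forall>\<^sub>F (x', y) in uniformity. x' = x \<longrightarrow> y \<in> U)"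
    for U :: "'a completion set"
    by (rule open_completion_def)
  show "(norm x = 0) = (x = 0)"
  proof transfer
    fix X :: "nat \<Rightarrow> 'a" assume "cauchy_rel X X"
    then have X: "Cauchy X" by (simp add: refl)
    show "(lim (\<lambda>n. norm (X n)) = 0) = cauchy_rel X (\<lambda>_. 0)"
    proof
      assume "lim (\<lambda>n. norm (X n)) = 0"
      then have "X \<longlonglongrightarrow> 0" using lim[OF X] by (simp add: tendsto_norm_zero_iff)
      then show "cauchy_rel X (\<lambda>_. 0)" using X C0 by (simp add: cauchy_rel_def)
    next
      assume "cauchy_rel X (\<lambda>_. 0)"
      then have "X \<longlonglongrightarrow> 0" by (simp add: cauchy_rel_def)
      then show "lim (\<lambda>n. norm (X n)) = 0" by (intro limI tendsto_norm_zero)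
    qed
  qed
  show "norm (x + y) \<le> norm x + norm y"
  proof transfer
    fix X Y :: "nat \<Rightarrow> 'a" assume "cauchy_rel X X" "cauchy_rel Y Y"
    then have X: "Cauchy X" "Cauchy Y" by (simp_all add: refl)
    show "lim (\<lambda>n. norm (X n + Y n)) \<le> lim (\<lambda>n. norm (X n)) + lim (\<lambda>n. norm (Y n))"
      by (rule LIMSEQ_le[OF lim[OF Cauchy_add[OF X]] tendsto_add[OF lim[OF X(1)] lim[OF X(2)]]])
        (use norm_triangle_ineq in blast)
  qed
  show "norm (a *\<^sub>R x) = \<bar>a\<bar> * norm x"
  proof transfer
    fix a :: real and X :: "nat \<Rightarrow> 'a" assume "cauchy_rel X X"
    then have X: "Cauchy X" by (simp add: refl)
    show "lim (\<lambda>n. norm (a *\<^sub>R X n)) = \<bar>a\<bar> * lim (\<lambda>n. norm (X n))"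
      using tendsto_mult_left[OF lim[OF X], of "\<bar>a\<bar>"] by (simp add: limI)
  qed
qed

end

lift_definition completion_embed :: "'a::real_normed_vector \<Rightarrow> 'a completion" is "\<lambda>x _. x"
  by (auto simp: cauchy_rel_def Cauchy_def)

lemma linear_completion_embed: "linear completion_embed"
proof
  show "completion_embed (x + y) = completion_embed x + completion_embed y" for x y :: 'a
    by transfer (auto simp: cauchy_rel_def Cauchy_def)
  show "completion_embed (c *\<^sub>R x) = c *\<^sub>R completion_embed x" for c and x :: 'a
    by transfer (auto simp: cauchy_rel_def Cauchy_def)
qed

lemma norm_completion_embed: "norm (completion_embed x) = norm x"
  by transfer simp

lemma minus_completion_abs:
  assumes "Cauchy X" "Cauchy Y"
  shows "abs_completion X - abs_completion Y = abs_completion (\<lambda>n. X n - Y n)"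
proof -
  have X: "cauchy_rel X X" "cauchy_rel Y Y" using assms by (auto simp: cauchy_rel_def)
  have C: "cauchy_rel (\<lambda>n. (-1) *\<^sub>R Y n) (\<lambda>n. (-1) *\<^sub>R Y n)"
    using Cauchy_scaleR[OF assms(2), of "-1"]
    by (simp add: cauchy_rel_def)
  show ?thesis
    unfolding minus_completion_def uminus_completion_def
    by (simp only: scaleR_completion.abs_eq[OF X(2)] plus_completion.abs_eq[OF X(1) C]) simp
qed

lemma norm_completion_abs:
  "Cauchy X \<Longrightarrow> (\<lambda>n. norm (X n)) \<longlonglongrightarrow> norm (abs_completion X)"
  using Cauchy_norm[of X] norm_completion.abs_eq[of X]
  by (simp add: cauchy_rel_def convergent_LIMSEQ_iff)

lemma completion_embed_tendsto:
  assumes X: "Cauchy X"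
  shows "(\<lambda>m. completion_embed (X m)) \<longlonglongrightarrow> abs_completion X"
proof (rule metric_LIMSEQ_I)
  fix e :: real assume e: "e > 0"
  then obtain N where N: "\<And>m n. m \<ge> N \<Longrightarrow> n \<ge> N \<Longrightarrow> dist (X m) (X n) < e / 2"
    using X by (meson metric_CauchyD half_gt_zero)
  have "dist (completion_embed (X m)) (abs_completion X) < e" if m: "m \<ge> N" for m
  proof -
    have C: "Cauchy (\<lambda>n. X m)" by (simp add: Cauchy_def)
    have "(\<lambda>n. norm (X m - X n)) \<longlonglongrightarrow> norm (completion_embed (X m) - abs_completion X)"
      using norm_completion_abs[OF Cauchy_diff[OF C X]] minus_completion_abs[OF C X]
      by (simp add: completion_embed.abs_eq)
    moreover have "\<forall>n\<ge>N. norm (X m - X n) \<le> e / 2"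
      using N m by (metis dist_norm less_imp_le)
    ultimately have "norm (completion_embed (X m) - abs_completion X) \<le> e / 2"
      by (intro LIMSEQ_le_const2) blast+
    then show ?thesis using e by (simp add: dist_norm)
  qed
  then show "\<exists>N. \<forall>m\<ge>N. dist (completion_embed (X m)) (abs_completion X) < e" by blast
qed

lemma completion_embed_dense: "closure (range completion_embed) = UNIV"
proof -
  have "x \<in> closure (range completion_embed)" for x :: "'a completion"
  proof (induction x)
    case (1 X)
    then have "Cauchy X" by (simp add: cauchy_rel_def)
    from completion_embed_tendsto[OF this] show ?case
      unfolding closure_sequential by (intro exI[of _ "\<lambda>m. completion_embed (X m)"]) simp
  qed
  then show ?thesis by auto
qed

instance completion :: (real_normed_vector) banach
proof
  fix x :: "nat \<Rightarrow> 'a completion" assume x: "Cauchy x"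
  have "\<exists>a. dist (completion_embed a) (x n) < inverse (real (Suc n))" for n
  proof -
    have "x n \<in> closure (range completion_embed)" by (simp add: completion_embed_dense)
    then show ?thesis
      unfolding closure_approachable
      by (metis inverse_positive_iff_positive of_nat_0_less_iff rangeE zero_less_Suc)
  qed
  then obtain a where a: "\<And>n. dist (completion_embed (a n)) (x n) < inverse (real (Suc n))"
    by metis
  have d: "(\<lambda>n. completion_embed (a n) - x n) \<longlonglongrightarrow> 0"
    by (rule Lim_null_comparison[OF _ LIMSEQ_inverse_real_of_nat])
      (use a in \<open>auto simp: dist_norm less_imp_le\<close>)
  have "Cauchy (\<lambda>n. x n + (completion_embed (a n) - x n))"
    by (rule Cauchy_add[OF x]) (use d in \<open>auto intro: LIMSEQ_imp_Cauchy\<close>)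
  then have "Cauchy (\<lambda>n. completion_embed (a n))" by simp
  then have "Cauchy a"
    unfolding Cauchy_def dist_norm
    by (simp add: linear_diff[OF linear_completion_embed, symmetric] norm_completion_embed)
  from tendsto_diff[OF completion_embed_tendsto[OF this] d]
  show "convergent x" by (auto simp: convergent_def)
qed

type_synonym 'a tc = "'a tp completion"


section \<open>The space \<open>\<ell>\<^sub>1\<close>\<close>

typedef ell1 = "{x :: nat \<Rightarrow> real. summable (\<lambda>n. \<bar>x n\<bar>)}"
  morphisms ell1_apply Abs_ell1
  by (rule exI[of _ "\<lambda>_. 0"]) simp

setup_lifting type_definition_ell1

lemma summable_abs_add:
  fixes x y :: "nat \<Rightarrow> real"
  assumes "summable (\<lambda>n. \<bar>x n\<bar>)" "summable (\<lambda>n. \<bar>y n\<bar>)"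
  shows "summable (\<lambda>n. \<bar>x n + y n\<bar>)"
  by (rule summable_comparison_test'[OF summable_add[OF assms]]) (simp add: abs_triangle_ineq)

instantiation ell1 :: real_vector
begin

lift_definition zero_ell1 :: ell1 is "\<lambda>_. 0" by simp

lift_definition plus_ell1 :: "ell1 \<Rightarrow> ell1 \<Rightarrow> ell1" is "\<lambda>x y n. x n + y n"
  by (rule summable_abs_add)

lift_definition scaleR_ell1 :: "real \<Rightarrow> ell1 \<Rightarrow> ell1" is "\<lambda>c x n. c * x n"
  by (simp add: abs_mult summable_mult)

lift_definition uminus_ell1 :: "ell1 \<Rightarrow> ell1" is "\<lambda>x n. - x n"
  by simp

lift_definition minus_ell1 :: "ell1 \<Rightarrow> ell1 \<Rightarrow> ell1" is "\<lambda>x y n. x n - y n"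
  using summable_abs_add[of _ "\<lambda>n. - _ n"] by simp

instance
proof
  fix x y z :: ell1 and a b :: real
  show "x + y + z = x + (y + z)" by transfer (simp add: add.assoc)
  show "x + y = y + x" by transfer (simp add: add.commute)
  show "0 + x = x" by transfer simp
  show "- x + x = 0" by transfer simp
  show "x - y = x + - y" by transfer simp
  show "a *\<^sub>R (x + y) = a *\<^sub>R x + a *\<^sub>R y" by transfer (simp add: algebra_simps)
  show "(a + b) *\<^sub>R x = a *\<^sub>R x + b *\<^sub>R x" by transfer (simp add: algebra_simps)
  show "a *\<^sub>R b *\<^sub>R x = (a * b) *\<^sub>R x" by transfer (simp add: mult.assoc)
  show "1 *\<^sub>R x = x" by transfer simp
qed

end

instantiation ell1 :: real_normed_vector
begin

lift_definition norm_ell1 :: "ell1 \<Rightarrow> real" is "\<lambda>x. \<Sum>n. \<bar>x n\<bar>" .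

definition dist_ell1 :: "ell1 \<Rightarrow> ell1 \<Rightarrow> real" where "dist_ell1 x y = norm (x - y)"

definition sgn_ell1 :: "ell1 \<Rightarrow> ell1" where "sgn_ell1 x = x /\<^sub>R norm x"

definition uniformity_ell1 :: "(ell1 \<times> ell1) filter" where
  "uniformity_ell1 = (INF e\<in>{0 <..}. principal {(x, y). dist x y < e})"

definition open_ell1 :: "ell1 set \<Rightarrow> bool" where
  "open_ell1 S = (\<forall>x\<in>S. \<forall>\<^sub>F (x', y) in uniformity. x' = x \<longrightarrow> y \<in> S)"

instance
proof
  fix x y :: ell1 and a :: real
  show "dist x y = norm (x - y)" by (rule dist_ell1_def)
  show "sgn x = x /\<^sub>R norm x" by (rule sgn_ell1_def)
  show "uniformity = (INF e\<in>{0 <..}. principal {(x, y :: ell1). dist x y < e})"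
    by (rule uniformity_ell1_def)
  show "open U = (\<forall>x\<in>U. \<forall>\<^sub>F (x', y) in uniformity. x' = x \<longrightarrow> y \<in> U)" for U :: "ell1 set"
    by (rule open_ell1_def)
  show "(norm x = 0) = (x = 0)"
    by transfer (auto simp: suminf_eq_zero_iff fun_eq_iff)
  show "norm (x + y) \<le> norm x + norm y"
    by transfer (simp add: suminf_add suminf_le summable_abs_add summable_add abs_triangle_ineq)
  show "norm (a *\<^sub>R x) = \<bar>a\<bar> * norm x"
    by transfer (simp add: abs_mult suminf_mult)
qed

end

definition linear_isometric_embedding ::
  "('a::real_normed_vector \<Rightarrow> 'b::real_normed_vector) \<Rightarrow> bool" where
  "linear_isometric_embedding T \<longleftrightarrow> linear T \<and> (\<forall>x. norm (T x) = norm x)"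

end

theory Submission
  imports Defs
begin

text \<open>
  Call a pair of points \<open>x \<noteq> y\<close> tight for \<open>f \<in> TC(M)\<close> if, for some \<open>a > 0\<close>, removing the
  transport of mass \<open>a\<close> from \<open>x\<close> to \<open>y\<close> lowers the norm of \<open>f\<close> by its full cost \<open>a d(x, y)\<close>;
  informally, an optimal plan for \<open>f\<close> sends mass from \<open>x\<close> to \<open>y\<close>. If \<open>\<parallel>f + g\<parallel> = \<parallel>f\<parallel> + \<parallel>g\<parallel>\<close> and
  \<open>(x, y)\<close>, \<open>(x', y')\<close> are tight for \<open>f\<close> and \<open>g\<close>, then exchanging the targets \<open>y\<close> and \<open>y'\<close> cannot
  save cost, so \<open>d(x, y) + d(x', y') \<le> d(x, y') + d(x', y)\<close> (\<open>tight_pairs_cross\<close>).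

  Let \<open>f\<^sub>i\<close> be the images of the unit vectors under an isometric embedding of \<open>\<ell>\<^sub>1\<close>, each with a
  tight pair \<open>(x\<^sub>i, y\<^sub>i)\<close>. Both \<open>\<parallel>f\<^sub>i + f\<^sub>j\<parallel>\<close> and \<open>\<parallel>f\<^sub>i - f\<^sub>j\<parallel>\<close> equal \<open>\<parallel>f\<^sub>i\<parallel> + \<parallel>f\<^sub>j\<parallel>\<close>, so the matching
  \<open>{x\<^sub>i, y\<^sub>i}, {x\<^sub>j, y\<^sub>j}\<close> is at least as cheap as either of the two other matchings of these points.
  As all triangle inequalities in \<open>M\<close> are strict, no point is the source of two of the tight pairs, or the target of
  two of them; hence there is a pair \<open>{x\<^sub>i, y\<^sub>i}\<close> whose indices exceed those of \<open>x\<^sub>0\<close> and \<open>y\<^sub>0\<close>.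
  All five metrics have the form \<open>d(v\<^sub>k, v\<^sub>n) = \<alpha>(k) + \<beta>(n)\<close> for \<open>k < n\<close> with \<open>\<alpha> - \<beta>\<close> strictly
  increasing, and for \<open>k < n < l < m\<close> this makes \<open>{v\<^sub>k, v\<^sub>m}, {v\<^sub>n, v\<^sub>l}\<close> strictly cheaper than
  \<open>{v\<^sub>k, v\<^sub>n}, {v\<^sub>l, v\<^sub>m}\<close>, a contradiction.

  What remains is that every nonzero \<open>f \<in> TC(M)\<close> has a tight pair (\<open>tight_pair_exists\<close>). The five
  metrics are equivalent to a star metric \<open>w(x) + w(y)\<close>, so that \<open>TC(M)\<close> is a space of functions with
  an equivalent weighted \<open>\<ell>\<^sub>1\<close> norm. Approximate \<open>f\<close> by finitely supported \<open>X\<^sub>m\<close> and take almost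
  optimal plans for \<open>X\<^sub>m\<close> in which no point both sends and receives mass. At a point \<open>u\<close> with
  \<open>f(u) > 0\<close> the plans send out a mass bounded below, while a set of receivers can only take in the
  mass that \<open>X\<^sub>m\<close> has there, which is small outside some finite set independent of \<open>m\<close>.
  So one of finitely many points receives from \<open>u\<close> an amount bounded below.
\<close>

section \<open>Transportation plans without transit\<close>

text \<open>The molecule \<open>1\<^sub>x - 1\<^sub>y\<close>.\<close>

lift_definition dipole :: "'a \<Rightarrow> 'a \<Rightarrow> 'a tp" is "\<lambda>x y v. indicator {x} v - indicator {y} v"
proof -
  fix x y :: 'a
  have "{v. indicator {x} v - indicator {y} v \<noteq> (0::real)} \<subseteq> {x, y}"
    by (auto simp: indicator_def)
  then show "finite {v. indicator {x} v - indicator {y} v \<noteq> (0::real)} \<and>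
    (\<Sum>v | indicator {x} v - indicator {y} v \<noteq> (0::real). indicator {x} v - indicator {y} v) = (0::real)"
    by (subst sum_support_eq[of "{x, y}"])
      (auto simp: sum_subtractf indicator_def intro: finite_subset)
qed

lemma tp_apply_dipole: "tp_apply (dipole x y) v = indicator {x} v - indicator {y} v"
  by transfer simp

lemma dipole_swap: "dipole y x = - dipole x y"
  by (rule tp_eqI) (simp add: tp_apply_dipole)

lemma dipole_refl [simp]: "dipole x x = 0"
  by (rule tp_eqI) (simp add: tp_apply_dipole)

lemma dipole_add: "dipole x y + dipole y z = dipole x z"
  by (rule tp_eqI) (simp add: tp_apply_dipole)

definition plan_sum :: "(real \<times> 'a \<times> 'a) list \<Rightarrow> 'a tp" where
  "plan_sum p = (\<Sum>(a, x, y)\<leftarrow>p. a *\<^sub>R dipole x y)"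

lemma tp_apply_plan_sum:
  "tp_apply (plan_sum p) v = (\<Sum>(a, x, y)\<leftarrow>p. a * (indicator {x} v - indicator {y} v))"
  by (induction p) (auto simp: plan_sum_def tp_apply_dipole)

lemma transport_plan_iff:
  "transport_plan f p \<longleftrightarrow> f = plan_sum p \<and> (\<forall>(a, x, y) \<in> set p. 0 \<le> a)"
  unfolding transport_plan_def tp_apply_plan_sum[symmetric] by (auto intro: tp_eqI)

lemma norm_tp_le: "transport_plan f p \<Longrightarrow> norm f \<le> plan_cost p"
  unfolding norm_tp_def
  by (rule cInf_lower) (use plan_cost_nonneg in \<open>auto intro!: bdd_belowI[of _ 0]\<close>)

lemma norm_tp_ge: "(\<And>p. transport_plan f p \<Longrightarrow> b \<le> plan_cost p) \<Longrightarrow> b \<le> norm f"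
  unfolding norm_tp_def by (rule cInf_greatest) (use plan_exists in auto)

lemma norm_tp_approx:
  assumes "e > 0"
  obtains p where "transport_plan f p" "plan_cost p < norm f + e"
  using norm_tp_ge[of f "norm f + e"] assms by fastforce

lemma norm_dipole_le: "norm (dipole x y) \<le> dist x (y::'a::metric_space)"
  using norm_tp_le[of "dipole x y" "[(1, x, y)]"]
  by (simp add: transport_plan_iff plan_sum_def plan_cost_def)

definition proper_plan :: "(real \<times> 'a \<times> 'a) list \<Rightarrow> bool" where
  "proper_plan p \<longleftrightarrow> (\<forall>(a, x, y) \<in> set p. 0 < a \<and> x \<noteq> y)"

definition sources :: "(real \<times> 'a \<times> 'a) list \<Rightarrow> 'a set" where
  "sources p = (\<lambda>(a, x, y). x) ` set p"

definition targets :: "(real \<times> 'a \<times> 'a) list \<Rightarrow> 'a set" where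
  "targets p = (\<lambda>(a, x, y). y) ` set p"

text \<open>
  Mass that arrives at \<open>u\<close> from \<open>x\<close> and leaves for \<open>z\<close> is sent directly from \<open>x\<close> to \<open>z\<close>. Each such
  rerouting uses up one of the two entries, so the number of entries that meet \<open>u\<close> drops. That no new
  sources or targets appear allows the vertices to be treated one after another.
\<close>

lemma eliminate_transit_at:
  fixes p :: "(real \<times> 'a::metric_space \<times> 'a) list"
  assumes "proper_plan p"
  shows "\<exists>q. proper_plan q \<and> plan_sum q = plan_sum p \<and> plan_cost q \<le> plan_cost p \<and>
    sources q \<subseteq> sources p \<and> targets q \<subseteq> targets p \<and> u \<notin> sources q \<inter> targets q"
  using assms
proof (induction "length (filter (\<lambda>(a, x, y). x = u \<or> y = u) p)" arbitrary: p rule: less_induct)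
  case less
  show ?case
  proof (cases "u \<in> sources p \<inter> targets p")
    case False
    then show ?thesis using less.prems by blast
  next
    case True
    then obtain a x b z where ax: "(a, x, u) \<in> set p" and bz: "(b, u, z) \<in> set p"
      unfolding sources_def targets_def by fastforce
    have pos: "a > 0" "b > 0" "x \<noteq> u" "u \<noteq> z"
      using ax bz less.prems unfolding proper_plan_def by fastforce+
    define r where "r = remove1 (b, u, z) (remove1 (a, x, u) p)"
    define s where "s = (if x = z then [] else [(min a b, x, z)]) @
      (if b < a then [(a - b, x, u)] else []) @ (if a < b then [(b - a, u, z)] else [])"
    have bz': "(b, u, z) \<in> set (remove1 (a, x, u) p)"
      using bz pos by (simp add: in_set_remove1)
    have split_p: "sum_list (map g p) = g (a, x, u) + (g (b, u, z) + sum_list (map g r))"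
      for g :: "real \<times> 'a \<times> 'a \<Rightarrow> 'b::ab_group_add"
      unfolding r_def using sum_list_map_remove1[OF ax, of g] sum_list_map_remove1[OF bz', of g] by simp
    have sub_r: "set r \<subseteq> set p" unfolding r_def by (meson order_trans set_remove1_subset)
    let ?deg = "\<lambda>p. length (filter (\<lambda>(a, x, y). x = u \<or> y = u) p)"
    have "length (filter (\<lambda>(a, x, y). x = u \<or> y = u) r) + 2 = ?deg p"
    proof -
      have deg: "int (?deg p) = (\<Sum>(a, x, y)\<leftarrow>p. if x = u \<or> y = u then 1 else 0)" for p
        by (induction p) (auto split: if_splits)
      show ?thesis using deg[of r] deg[of p] split_p[of "\<lambda>(a, x, y). if x = u \<or> y = u then 1 else (0::int)"]
        by simp
    qed
    \<comment> \<open>At most one of the two remainders in \<open>s\<close> is present, and the rerouted entry avoids \<open>u\<close>.\<close>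
    moreover have "?deg s \<le> 1" unfolding s_def using pos by auto
    ultimately have "?deg (s @ r) < ?deg p" by simp
    moreover have "proper_plan (s @ r)"
      using less.prems sub_r pos unfolding proper_plan_def s_def by auto
    ultimately obtain q where q: "proper_plan q" "plan_sum q = plan_sum (s @ r)"
      "plan_cost q \<le> plan_cost (s @ r)" "sources q \<subseteq> sources (s @ r)"
      "targets q \<subseteq> targets (s @ r)" "u \<notin> sources q \<inter> targets q"
      using less.hyps by blast
    have "plan_sum s = a *\<^sub>R dipole x u + b *\<^sub>R dipole u z"
    proof -
      have xz: "dipole x z = dipole x u + dipole u z" by (simp add: dipole_add)
      have *: "dipole x u + dipole u x = 0" by (simp add: dipole_add)
      have "min a b *\<^sub>R dipole x z + max 0 (a - b) *\<^sub>R dipole x u + max 0 (b - a) *\<^sub>R dipole u z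
        = a *\<^sub>R dipole x u + b *\<^sub>R dipole u z"
        unfolding xz by (cases "a \<le> b") (auto simp: algebra_simps)
      moreover have "plan_sum s = min a b *\<^sub>R dipole x z + max 0 (a - b) *\<^sub>R dipole x u
          + max 0 (b - a) *\<^sub>R dipole u z"
        unfolding s_def plan_sum_def by auto
      ultimately show ?thesis by simp
    qed
    then have sum: "plan_sum (s @ r) = plan_sum p"
      unfolding plan_sum_def using split_p[of "\<lambda>(a, x, y). a *\<^sub>R dipole x y"]
      by (simp add: add.assoc)
    have "plan_cost s = min a b * dist x z + max 0 (a - b) * dist x u + max 0 (b - a) * dist u z"
      unfolding s_def plan_cost_def by auto
    also have "\<dots> \<le> min a b * (dist x u + dist u z) + max 0 (a - b) * dist x u + max 0 (b - a) * dist u z"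
      using pos by (intro add_right_mono mult_left_mono dist_triangle) auto
    also have "\<dots> = a * dist x u + b * dist u z"
      by (cases "a \<le> b") (auto simp: algebra_simps)
    finally have cost: "plan_cost (s @ r) \<le> plan_cost p"
      unfolding plan_cost_def using split_p[of "\<lambda>(a, x, y). a * dist x y"] by simp
    have "sources (s @ r) \<subseteq> sources p" "targets (s @ r) \<subseteq> targets p"
      using sub_r ax bz unfolding sources_def targets_def s_def by (auto split: if_splits) force+
    with q sum cost show ?thesis by (intro exI[of _ q]) auto
  qed
qed

lemma proper_plan_exists:
  fixes p :: "(real \<times> 'a::metric_space \<times> 'a) list"
  assumes "transport_plan f p"
  shows "\<exists>q. proper_plan q \<and> plan_sum q = f \<and> plan_cost q = plan_cost p"
proof -
  let ?q = "filter (\<lambda>(a, x, y). 0 < a \<and> x \<noteq> y) p"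
  have "(\<forall>(a, x, y) \<in> set p. 0 \<le> a) \<Longrightarrow> plan_sum ?q = plan_sum p \<and> plan_cost ?q = plan_cost p"
    by (induction p) (auto simp: plan_sum_def plan_cost_def)
  then show ?thesis
    using assms unfolding transport_plan_iff by (intro exI[of _ ?q]) (auto simp: proper_plan_def)
qed

lemma no_transit_plan:
  fixes f :: "'a::metric_space tp"
  assumes "e > 0"
  obtains p where "proper_plan p" "plan_sum p = f" "plan_cost p < norm f + e"
    "sources p \<inter> targets p = {}"
proof -
  obtain p0 where "transport_plan f p0" "plan_cost p0 < norm f + e"
    using norm_tp_approx[OF assms] .
  then obtain p where p: "proper_plan p" "plan_sum p = f" "plan_cost p < norm f + e"
    using proper_plan_exists by metis
  have "\<exists>q. proper_plan q \<and> plan_sum q = plan_sum p \<and> plan_cost q \<le> plan_cost p \<and>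
    sources q \<subseteq> sources p \<and> targets q \<subseteq> targets p \<and> sources q \<inter> targets q \<inter> U = {}"
    if "finite U" for U
    using that
  proof (induction U)
    case empty
    then show ?case using p by blast
  next
    case (insert u U)
    then obtain q where q: "proper_plan q" "plan_sum q = plan_sum p" "plan_cost q \<le> plan_cost p"
      "sources q \<subseteq> sources p" "targets q \<subseteq> targets p" "sources q \<inter> targets q \<inter> U = {}"
      by blast
    obtain q' where "proper_plan q'" "plan_sum q' = plan_sum q" "plan_cost q' \<le> plan_cost q"
      "sources q' \<subseteq> sources q" "targets q' \<subseteq> targets q" "u \<notin> sources q' \<inter> targets q'"
      using eliminate_transit_at[OF q(1)] by blast
    with q show ?case by (intro exI[of _ q']) auto
  qed
  from this[of "sources p"] obtain q where "proper_plan q" "plan_sum q = plan_sum p"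
    "plan_cost q \<le> plan_cost p" "sources q \<subseteq> sources p" "sources q \<inter> targets q \<inter> sources p = {}"
    by (auto simp: sources_def)
  with p show ?thesis by (intro that[of q]) auto
qed

section \<open>Flows and the weighted sum of coordinates\<close>

definition flow :: "(real \<times> 'a \<times> 'a) list \<Rightarrow> 'a \<Rightarrow> 'a \<Rightarrow> real" where
  "flow p u y = (\<Sum>(a, x, z)\<leftarrow>p. if x = u \<and> z = y then a else 0)"

lemma norm_minus_dipole_le:
  assumes "proper_plan p" "0 \<le> a" "a \<le> flow p u y"
  shows "norm (plan_sum p - a *\<^sub>R dipole u y) \<le> plan_cost p - a * dist u y"
proof -
  let ?r = "filter (\<lambda>(a, x, z). \<not> (x = u \<and> z = y)) p"
  have sum: "plan_sum p = flow p u y *\<^sub>R dipole u y + plan_sum ?r"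
    unfolding plan_sum_def flow_def by (induction p) (auto simp: scaleR_add_left)
  have cost: "plan_cost p = flow p u y * dist u y + plan_cost ?r"
    unfolding plan_cost_def flow_def by (induction p) (auto simp: distrib_right)
  have "transport_plan (plan_sum ?r) ?r"
    using assms(1) by (auto simp: transport_plan_iff proper_plan_def intro: less_imp_le)
  then have "norm (plan_sum ?r) \<le> plan_cost ?r" by (rule norm_tp_le)
  moreover have "norm ((flow p u y - a) *\<^sub>R dipole u y) \<le> (flow p u y - a) * dist u y"
    using assms norm_dipole_le[of u y] by (simp add: mult_left_mono)
  moreover have "plan_sum p - a *\<^sub>R dipole u y = (flow p u y - a) *\<^sub>R dipole u y + plan_sum ?r"
    unfolding sum by (simp add: algebra_simps)
  ultimately show ?thesis
    using norm_triangle_ineq[of "(flow p u y - a) *\<^sub>R dipole u y" "plan_sum ?r"] cost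
    by (simp add: algebra_simps)
qed

lemma sum_flow:
  assumes "u \<notin> targets p"
  shows "tp_apply (plan_sum p) u = (\<Sum>y\<in>targets p. flow p u y)"
proof -
  have "\<forall>t\<in>set q. t \<in> set p \<Longrightarrow> tp_apply (plan_sum q) u = (\<Sum>y\<in>targets p. flow q u y)" for q
  proof (induction q)
    case Nil
    then show ?case by (simp add: plan_sum_def flow_def)
  next
    case (Cons t q)
    obtain a x z where t: "t = (a, x, z)" by (cases t)
    have z: "z \<in> targets p" "z \<noteq> u" and fin: "finite (targets p)"
      using Cons.prems assms by (force simp: t targets_def)+
    have "tp_apply (plan_sum (t # q)) u = a * indicator {x} u + tp_apply (plan_sum q) u"
      using z by (simp add: t plan_sum_def tp_apply_dipole)
    also have "a * indicator {x} u = (\<Sum>y\<in>targets p. if z = y then if x = u then a else 0 else 0)"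
      using z fin by simp
    also have "\<dots> = (\<Sum>y\<in>targets p. if x = u \<and> z = y then a else 0)"
      by (intro sum.cong) auto
    finally show ?case using Cons by (simp add: t flow_def sum.distrib)
  qed
  then show ?thesis by blast
qed

lemma flow_le:
  assumes "proper_plan p" "y \<notin> sources p"
  shows "flow p u y \<le> \<bar>tp_apply (plan_sum p) y\<bar>"
proof -
  have "flow p u y \<le> (\<Sum>(a, x, z)\<leftarrow>p. - (a * (indicator {x} y - indicator {z} y)))"
    unfolding flow_def
    by (rule sum_list_mono) (use assms in \<open>force simp: proper_plan_def sources_def indicator_def\<close>)
  also have "\<dots> = - tp_apply (plan_sum p) y"
    unfolding tp_apply_plan_sum by (induction p) auto
  finally show ?thesis by simp
qed

lemma tp_apply_nonpos:
  assumes "proper_plan p" "u \<notin> sources p"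
  shows "tp_apply (plan_sum p) u \<le> 0"
  unfolding tp_apply_plan_sum
  by (rule sum_list_nonpos)
    (use assms in \<open>force simp: proper_plan_def sources_def indicator_def\<close>)

lemma tp_apply_sum: "tp_apply (sum g S) v = (\<Sum>u\<in>S. tp_apply (g u) v)"
  by (induction S rule: infinite_finite_induct) auto

text \<open>All mass is routed through \<open>x0\<close>.\<close>

lemma norm_le_weighted_sum:
  fixes f :: "'a::metric_space tp"
  assumes "finite S" "{v. tp_apply f v \<noteq> 0} \<subseteq> S"
  shows "norm f \<le> (\<Sum>v\<in>S. \<bar>tp_apply f v\<bar> * dist v x0)"
proof -
  have "f = (\<Sum>v\<in>S. tp_apply f v *\<^sub>R dipole v x0)"
  proof (rule tp_eqI)
    fix v
    have "tp_apply (\<Sum>v\<in>S. tp_apply f v *\<^sub>R dipole v x0) v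
      = (\<Sum>u\<in>S. tp_apply f u * indicator {u} v) - (\<Sum>u\<in>S. tp_apply f u) * indicator {x0} v"
      by (simp add: tp_apply_sum tp_apply_dipole right_diff_distrib sum_subtractf sum_distrib_right)
    also have "(\<Sum>u\<in>S. tp_apply f u) = 0"
      using sum_support_eq[OF assms] sum_tp_support[of f] by simp
    also have "(\<Sum>u\<in>S. tp_apply f u * indicator {u} v) = (\<Sum>u\<in>S. if v = u then tp_apply f u else 0)"
      by (intro sum.cong) (auto simp: indicator_def)
    also have "\<dots> = tp_apply f v"
      using assms by (subst sum.delta') auto
    finally show "tp_apply f v = tp_apply (\<Sum>v\<in>S. tp_apply f v *\<^sub>R dipole v x0) v"
      by simp
  qed
  then have "norm f \<le> (\<Sum>v\<in>S. norm (tp_apply f v *\<^sub>R dipole v x0))"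
    by (metis norm_sum)
  also have "\<dots> \<le> (\<Sum>v\<in>S. \<bar>tp_apply f v\<bar> * dist v x0)"
    by (intro sum_mono) (simp add: mult_left_mono norm_dipole_le)
  finally show ?thesis .
qed

text \<open>
  Under the star condition every function with \<open>\<bar>g v\<bar> \<le> c (1 + d(v, x0))\<close> is 1-Lipschitz, whatever
  its signs. Giving \<open>g\<close> the signs of \<open>f\<close> and pairing it with a plan for \<open>f\<close> yields the bound.
\<close>

lemma weighted_sum_le_norm:
  fixes f :: "'a::metric_space tp"
  assumes c: "c > 0" and star: "\<And>x y::'a. x \<noteq> y \<Longrightarrow> c * (2 + dist x x0 + dist y x0) \<le> dist x y"
    and S: "finite S"
  shows "c * (\<Sum>v\<in>S. \<bar>tp_apply f v\<bar> * (1 + dist v x0)) \<le> norm f"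
proof (rule norm_tp_ge)
  fix p assume p: "transport_plan f p"
  define g where "g v = (if v \<in> S then c * sgn (tp_apply f v) * (1 + dist v x0) else 0)" for v
  have bound: "\<bar>g v\<bar> \<le> c * (1 + dist v x0)" for v
  proof -
    have "\<bar>sgn (tp_apply f v)\<bar> \<le> 1" by (simp add: sgn_if)
    then have "c * \<bar>sgn (tp_apply f v)\<bar> * (1 + dist v x0) \<le> c * 1 * (1 + dist v x0)"
      using c by (intro mult_left_mono mult_right_mono) auto
    then show ?thesis using c by (auto simp: g_def abs_mult)
  qed
  have "\<bar>g x - g y\<bar> \<le> dist x y" for x y
  proof (cases "x = y")
    case False
    then show ?thesis
      using star[OF False] bound[of x] bound[of y] by (simp add: algebra_simps)
  qed simp
  from plan_pairing[OF p this]
  have "(\<Sum>v | tp_apply f v \<noteq> 0. tp_apply f v * g v) \<le> plan_cost p" .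
  also have "(\<Sum>v | tp_apply f v \<noteq> 0. tp_apply f v * g v) = (\<Sum>v\<in>S. tp_apply f v * g v)"
    by (rule sum.mono_neutral_cong) (use S finite_tp_support[of f] in \<open>auto simp: g_def\<close>)
  also have "\<dots> = (\<Sum>v\<in>S. c * (\<bar>tp_apply f v\<bar> * (1 + dist v x0)))"
    by (intro sum.cong) (auto simp: g_def abs_sgn)
  finally show "c * (\<Sum>v\<in>S. \<bar>tp_apply f v\<bar> * (1 + dist v x0)) \<le> plan_cost p"
    by (simp add: sum_distrib_left)
qed

section \<open>Tight pairs\<close>

text \<open>
  Defined through the norm alone, since elements of the completion come without plans of their own.
\<close>

definition tight_pair :: "'a::metric_space tc \<Rightarrow> 'a \<Rightarrow> 'a \<Rightarrow> bool" where
  "tight_pair f x y \<longleftrightarrow> x \<noteq> y \<and>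
     (\<exists>a>0. norm (f - a *\<^sub>R completion_embed (dipole x y)) + a * dist x y \<le> norm f)"

lemmas embed_add = linear_add[OF linear_completion_embed]
lemmas embed_diff = linear_diff[OF linear_completion_embed]
lemmas embed_scaleR = linear_scale[OF linear_completion_embed]
lemmas embed_neg = linear_neg[OF linear_completion_embed]

lemma tight_pair_minus: "tight_pair f x y \<Longrightarrow> tight_pair (- f) y x"
proof -
  have "- f - a *\<^sub>R completion_embed (dipole y x) = - (f - a *\<^sub>R completion_embed (dipole x y))" for a
    by (simp add: dipole_swap[of y x] embed_neg)
  then show "tight_pair f x y \<Longrightarrow> tight_pair (- f) y x"
    unfolding tight_pair_def by (metis dist_commute norm_minus_cancel)
qed

lemma tight_pair_smaller:
  fixes f :: "'a::metric_space tc"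
  assumes "norm (f - a *\<^sub>R completion_embed (dipole x y)) + a * dist x y \<le> norm f" "b \<le> a"
  shows "norm (f - b *\<^sub>R completion_embed (dipole x y)) + b * dist x y \<le> norm f"
proof -
  let ?d = "completion_embed (dipole x y)"
  have "norm ((a - b) *\<^sub>R ?d) \<le> (a - b) * dist x y"
    using assms(2) norm_dipole_le[of x y] by (simp add: norm_completion_embed mult_left_mono)
  moreover have "f - b *\<^sub>R ?d = (f - a *\<^sub>R ?d) + (a - b) *\<^sub>R ?d"
    by (simp add: algebra_simps)
  ultimately show ?thesis
    using assms(1) norm_triangle_ineq[of "f - a *\<^sub>R ?d" "(a - b) *\<^sub>R ?d"] by (simp add: algebra_simps)
qed

text \<open>
  A common amount \<open>t\<close> is removed from both tight pairs and transported back with the targets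
  exchanged; the result is again \<open>f + g\<close>, whose norm has no slack.
\<close>

lemma tight_pairs_cross:
  fixes f g :: "'a::metric_space tc"
  assumes "tight_pair f x y" "tight_pair g x' y'" "norm (f + g) = norm f + norm g"
  shows "dist x y + dist x' y' \<le> dist x y' + dist x' y"
proof -
  obtain a b where ab: "a > 0" "b > 0"
    "norm (f - a *\<^sub>R completion_embed (dipole x y)) + a * dist x y \<le> norm f"
    "norm (g - b *\<^sub>R completion_embed (dipole x' y')) + b * dist x' y' \<le> norm g"
    using assms(1,2) unfolding tight_pair_def by blast
  define t where "t = min a b"
  let ?f = "f - t *\<^sub>R completion_embed (dipole x y)"
  let ?g = "g - t *\<^sub>R completion_embed (dipole x' y')"
  let ?h = "t *\<^sub>R completion_embed (dipole x y' + dipole x' y)"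
  have t: "t > 0" "norm ?f + t * dist x y \<le> norm f" "norm ?g + t * dist x' y' \<le> norm g"
    using ab tight_pair_smaller[of f a x y t] tight_pair_smaller[of g b x' y' t]
    by (auto simp: t_def)
  have dip: "dipole x y + dipole x' y' = dipole x y' + dipole x' y"
    by (rule tp_eqI) (simp add: tp_apply_dipole)
  have "f + g = ?f + ?g + t *\<^sub>R (completion_embed (dipole x y) + completion_embed (dipole x' y'))"
    by (simp add: algebra_simps)
  also have "\<dots> = ?f + ?g + ?h"
    by (simp only: embed_add[symmetric] dip)
  finally have "norm (f + g) \<le> norm ?f + norm ?g + norm ?h"
    by (metis norm_triangle_le norm_triangle_ineq add_right_mono)
  moreover have "norm (dipole x y' + dipole x' y) \<le> dist x y' + dist x' y"
    using norm_triangle_ineq[of "dipole x y'" "dipole x' y"] norm_dipole_le[of x y']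
      norm_dipole_le[of x' y] by linarith
  then have "norm ?h \<le> t * (dist x y' + dist x' y)"
    using t(1) by (simp add: norm_completion_embed mult_left_mono)
  ultimately have "t * (dist x y + dist x' y') \<le> t * (dist x y' + dist x' y)"
    using t(2,3) assms(3) by (simp add: distrib_left)
  then show ?thesis using t(1) by simp
qed

text \<open>
  The tightness argument: for large \<open>m\<close> the point \<open>u\<close> sends out more than \<open>b = L / 2\<close> in a
  transit-free plan for \<open>X m\<close>. Outside the support \<open>F\<close> of a fixed good approximation \<open>X N\<close> at most
  \<open>b / 2\<close> can be received, so some point of \<open>F\<close> gets at least the constant amount \<open>a\<close> from \<open>u\<close>.
  If no point of \<open>F\<close> formed a tight pair with \<open>u\<close> for this \<open>a\<close>, then for large \<open>m\<close> removing
  the amount \<open>a\<close> would be too expensive for all points of the finite set \<open>F\<close> at once.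
\<close>

lemma tight_pair_at_positive_coordinate:
  fixes f :: "'a::metric_space tc"
  assumes c: "c > 0" and star: "\<And>x y::'a. x \<noteq> y \<Longrightarrow> c * (2 + dist x x0 + dist y x0) \<le> dist x y"
    and X: "(\<lambda>m. completion_embed (X m)) \<longlonglongrightarrow> f"
    and L: "(\<lambda>m. tp_apply (X m) u) \<longlonglongrightarrow> L" "L > 0"
  shows "\<exists>y. tight_pair f u y"
proof -
  define b where "b = L / 2"
  have b: "b > 0" "b < L" using L by (simp_all add: b_def)
  have "Cauchy (\<lambda>m. completion_embed (X m))" using X by (rule LIMSEQ_imp_Cauchy)
  moreover have "c * b / 2 > 0" using b c by simp
  ultimately obtain N where "\<forall>m\<ge>N. \<forall>n\<ge>N. dist (completion_embed (X m)) (completion_embed (X n)) < c * b / 2"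
    unfolding Cauchy_def by metis
  then have N: "norm (X m - X N) < c * b / 2" if "m \<ge> N" for m
    using that by (simp add: dist_norm embed_diff[symmetric] norm_completion_embed)
  define F where "F = {v. tp_apply (X N) v \<noteq> 0}"
  have F: "finite F" unfolding F_def by (rule finite_tp_support)
  define a where "a = b / (2 * (real (card F) + 1))"
  have a: "a > 0" using b by (simp add: a_def add_nonneg_pos)
  have key: "\<exists>y\<in>F - {u}. norm (X m - a *\<^sub>R dipole u y) < norm (X m) + inverse (real (Suc m)) - a * dist u y"
    if m: "m \<ge> N" "tp_apply (X m) u > b" for m
  proof -
    have "inverse (real (Suc m)) > 0" by simp
    then obtain p where p: "proper_plan p" "plan_sum p = X m"
      "plan_cost p < norm (X m) + inverse (real (Suc m))" "sources p \<inter> targets p = {}"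
      using no_transit_plan by metis
    let ?T = "targets p"
    have finT: "finite ?T" by (simp add: targets_def)
    have u: "u \<notin> ?T"
      using tp_apply_nonpos[OF p(1), of u] p(2,4) m(2) b(1) by force
    have "(\<Sum>y\<in>?T - F. flow p u y) \<le> (\<Sum>y\<in>?T - F. \<bar>tp_apply (X m - X N) y\<bar> * (1 + dist y x0))"
    proof (rule sum_mono)
      fix y assume y: "y \<in> ?T - F"
      then have "flow p u y \<le> \<bar>tp_apply (X m) y\<bar>"
        using flow_le[OF p(1), of y u] p(2,4) by auto
      also have "\<dots> = \<bar>tp_apply (X m - X N) y\<bar> * 1" using y by (simp add: F_def)
      also have "\<dots> \<le> \<bar>tp_apply (X m - X N) y\<bar> * (1 + dist y x0)"
        by (intro mult_left_mono) auto
      finally show "flow p u y \<le> \<bar>tp_apply (X m - X N) y\<bar> * (1 + dist y x0)" .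
    qed
    moreover have "c * (\<Sum>y\<in>?T - F. \<bar>tp_apply (X m - X N) y\<bar> * (1 + dist y x0)) \<le> c * (b / 2)"
      using weighted_sum_le_norm[OF c star, of "?T - F" "X m - X N"] N[OF m(1)] finT by simp
    ultimately have outside: "(\<Sum>y\<in>?T - F. flow p u y) \<le> b / 2" using c by simp
    have "b < (\<Sum>y\<in>?T. flow p u y)" using sum_flow[OF u] p(2) m(2) by simp
    also have "\<dots> = (\<Sum>y\<in>?T \<inter> F. flow p u y) + (\<Sum>y\<in>?T - F. flow p u y)"
      using finT by (rule sum.Int_Diff)
    finally have inside: "b / 2 < (\<Sum>y\<in>?T \<inter> F. flow p u y)" using outside by simp
    have "\<exists>y\<in>?T \<inter> F. a \<le> flow p u y"
    proof (rule ccontr)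
      assume "\<not> ?thesis"
      then have "(\<Sum>y\<in>?T \<inter> F. flow p u y) \<le> real (card (?T \<inter> F)) * a"
        by (intro sum_bounded_above) (auto simp: not_le less_imp_le)
      also have "\<dots> \<le> (real (card F) + 1) * a"
        using a F card_mono[of F "?T \<inter> F"] by (intro mult_right_mono) auto
      also have "\<dots> = b / 2" by (simp add: a_def field_simps)
      finally show False using inside by simp
    qed
    then obtain y where y: "y \<in> ?T" "y \<in> F" "a \<le> flow p u y" by blast
    have "norm (X m - a *\<^sub>R dipole u y) \<le> plan_cost p - a * dist u y"
      using norm_minus_dipole_le[OF p(1) _ y(3)] a p(2) by simp
    then show ?thesis using y u p(3) by (intro bexI[of _ y]) auto
  qed
  have "\<exists>y\<in>F - {u}. norm (f - a *\<^sub>R completion_embed (dipole u y)) + a * dist u y \<le> norm f"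
  proof (rule ccontr)
    assume "\<not> ?thesis"
    then have neg: "norm f < norm (f - a *\<^sub>R completion_embed (dipole u y)) + a * dist u y"
      if "y \<in> F - {u}" for y using that by force
    have "\<forall>\<^sub>F m in sequentially. norm (X m) + inverse (real (Suc m)) < norm (X m - a *\<^sub>R dipole u y) + a * dist u y"
      if y: "y \<in> F - {u}" for y
    proof -
      have "(\<lambda>m. (norm (completion_embed (X m) - a *\<^sub>R completion_embed (dipole u y)) + a * dist u y)
          - (norm (completion_embed (X m)) + inverse (real (Suc m))))
        \<longlonglongrightarrow> (norm (f - a *\<^sub>R completion_embed (dipole u y)) + a * dist u y) - (norm f + 0)"
        by (intro tendsto_intros X LIMSEQ_inverse_real_of_nat)
      then have "\<forall>\<^sub>F m in sequentially. 0 <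
        (norm (completion_embed (X m) - a *\<^sub>R completion_embed (dipole u y)) + a * dist u y)
          - (norm (completion_embed (X m)) + inverse (real (Suc m)))"
        using neg[OF y] by (intro order_tendstoD(1)) auto
      then show ?thesis
        by (simp add: embed_scaleR[symmetric] embed_diff[symmetric] norm_completion_embed)
    qed
    then have "\<forall>\<^sub>F m in sequentially. \<forall>y\<in>F - {u}.
        norm (X m) + inverse (real (Suc m)) < norm (X m - a *\<^sub>R dipole u y) + a * dist u y"
      using F by (intro eventually_ball_finite) auto
    moreover have "\<forall>\<^sub>F m in sequentially. b < tp_apply (X m) u"
      using L(1) b(2) by (rule order_tendstoD(1))
    ultimately have "\<forall>\<^sub>F m in sequentially. False"
      using eventually_ge_at_top[of N]
    proof eventually_elim
      case (elim m)
      obtain y where "y \<in> F - {u}"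
        "norm (X m - a *\<^sub>R dipole u y) < norm (X m) + inverse (real (Suc m)) - a * dist u y"
        using key[OF elim(3,2)] by blast
      with bspec[OF elim(1), of y] show False by linarith
    qed
    then show False by simp
  qed
  then obtain y where "y \<noteq> u" "norm (f - a *\<^sub>R completion_embed (dipole u y)) + a * dist u y \<le> norm f"
    by blast
  then have "tight_pair f u y" using a unfolding tight_pair_def by metis
  then show ?thesis ..
qed

text \<open>
  The coordinates of the approximations converge by \<open>weighted_sum_le_norm\<close>. They cannot all tend to
  \<open>0\<close>: then, on the finite support of a good approximation \<open>X N\<close>, letting \<open>m\<close> tend to infinity in
  the bound for \<open>X m - X N\<close> would make the weighted sum of \<open>X N\<close>, and hence its norm, small.
\<close>

lemma tight_pair_exists:
  fixes f :: "'a::metric_space tc"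
  assumes c: "c > 0" and star: "\<And>x y::'a. x \<noteq> y \<Longrightarrow> c * (2 + dist x x0 + dist y x0) \<le> dist x y"
    and "f \<noteq> 0"
  shows "\<exists>x y. tight_pair f x y"
proof -
  have "f \<in> closure (range completion_embed)" by (simp add: completion_embed_dense)
  then obtain Y where Y: "\<forall>m. Y m \<in> range completion_embed" "Y \<longlonglongrightarrow> f"
    unfolding closure_sequential by blast
  have "\<forall>m. \<exists>g. Y m = completion_embed g" using Y(1) by blast
  then obtain X where "\<forall>m. Y m = completion_embed (X m)" by (rule choice[THEN exE])
  then have "Y = (\<lambda>m. completion_embed (X m))" by blast
  with Y(2) have X: "(\<lambda>m. completion_embed (X m)) \<longlonglongrightarrow> f" by simp
  have Cauchy_X: "Cauchy X"
    using LIMSEQ_imp_Cauchy[OF X] unfolding Cauchy_def dist_norm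
    by (simp add: embed_diff[symmetric] norm_completion_embed)
  have norm_X: "(\<lambda>m. norm (X m)) \<longlonglongrightarrow> norm f"
    using tendsto_norm[OF X] by (simp add: norm_completion_embed)
  have "convergent (\<lambda>m. tp_apply (X m) u)" for u
  proof -
    have "Cauchy (\<lambda>m. tp_apply (X m) u)"
      unfolding Cauchy_def
    proof (intro allI impI)
      fix e :: real assume "e > 0"
      then obtain M where M: "\<And>m n. m \<ge> M \<Longrightarrow> n \<ge> M \<Longrightarrow> dist (X m) (X n) < c * e"
        using metric_CauchyD[OF Cauchy_X, of "c * e"] c by auto
      have "dist (tp_apply (X m) u) (tp_apply (X n) u) < e" if "m \<ge> M" "n \<ge> M" for m n
      proof -
        have "c * (\<bar>tp_apply (X m - X n) u\<bar> * 1) \<le> c * (\<bar>tp_apply (X m - X n) u\<bar> * (1 + dist u x0))"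
          using c by (intro mult_left_mono) auto
        also have "\<dots> \<le> norm (X m - X n)"
          using weighted_sum_le_norm[OF c star, of "{u}" "X m - X n"] by simp
        also have "\<dots> < c * e" using M[OF that] by (simp add: dist_norm)
        finally show ?thesis using c by (simp add: dist_real_def)
      qed
      then show "\<exists>M. \<forall>m\<ge>M. \<forall>n\<ge>M. dist (tp_apply (X m) u) (tp_apply (X n) u) < e" by blast
    qed
    then show ?thesis by (simp add: Cauchy_convergent_iff)
  qed
  then obtain L where L: "\<And>u. (\<lambda>m. tp_apply (X m) u) \<longlonglongrightarrow> L u"
    unfolding convergent_def by metis
  have "\<exists>u. L u \<noteq> 0"
  proof (rule ccontr)
    assume "\<not> ?thesis"
    with L have L0: "(\<lambda>m. tp_apply (X m) u) \<longlonglongrightarrow> 0" for u by metis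
    define e where "e = norm f / 2"
    have e: "0 < e" "e < norm f" using \<open>f \<noteq> 0\<close> by (simp_all add: e_def)
    obtain M where M: "\<And>m n. m \<ge> M \<Longrightarrow> n \<ge> M \<Longrightarrow> dist (X m) (X n) < c * e"
      using metric_CauchyD[OF Cauchy_X, of "c * e"] c e by auto
    obtain N where N: "N \<ge> M" "norm (X N) > e"
      using order_tendstoD(1)[OF norm_X e(2)] eventually_ge_at_top[of M]
      by (metis (mono_tags, lifting) eventually_sequentially eventually_conj order_refl)
    define S where "S = {v. tp_apply (X N) v \<noteq> 0}"
    have S: "finite S" unfolding S_def by (rule finite_tp_support)
    have "(\<lambda>m. c * (\<Sum>v\<in>S. \<bar>tp_apply (X m) v - tp_apply (X N) v\<bar> * (1 + dist v x0)))
      \<longlonglongrightarrow> c * (\<Sum>v\<in>S. \<bar>0 - tp_apply (X N) v\<bar> * (1 + dist v x0))"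
      by (intro tendsto_intros L0)
    moreover have "c * (\<Sum>v\<in>S. \<bar>tp_apply (X m) v - tp_apply (X N) v\<bar> * (1 + dist v x0)) \<le> c * e"
      if "m \<ge> M" for m
      using weighted_sum_le_norm[OF c star S, of "X m - X N"] M[OF that N(1)] by (simp add: dist_norm)
    ultimately have "c * (\<Sum>v\<in>S. \<bar>0 - tp_apply (X N) v\<bar> * (1 + dist v x0)) \<le> c * e"
      by (intro LIMSEQ_le_const2) blast+
    then have "(\<Sum>v\<in>S. \<bar>tp_apply (X N) v\<bar> * (1 + dist v x0)) \<le> e" using c by simp
    moreover have "norm (X N) \<le> (\<Sum>v\<in>S. \<bar>tp_apply (X N) v\<bar> * dist v x0)"
      using norm_le_weighted_sum[OF S, of "X N" x0] by (simp add: S_def)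
    moreover have "\<dots> \<le> (\<Sum>v\<in>S. \<bar>tp_apply (X N) v\<bar> * (1 + dist v x0))"
      by (intro sum_mono mult_left_mono) auto
    ultimately show False using N(2) by linarith
  qed
  then obtain u where "L u > 0 \<or> L u < 0" using not_less_iff_gr_or_eq by blast
  then show ?thesis
  proof
    assume "L u > 0"
    then show ?thesis using tight_pair_at_positive_coordinate[OF c star X L] by blast
  next
    assume "L u < 0"
    have "(\<lambda>m. completion_embed (- X m)) \<longlonglongrightarrow> - f"
      using tendsto_minus[OF X] by (simp add: embed_neg)
    moreover have "(\<lambda>m. tp_apply (- X m) u) \<longlonglongrightarrow> - L u"
      using tendsto_minus[OF L] by simp
    ultimately obtain y where "tight_pair (- f) u y"
      using tight_pair_at_positive_coordinate[OF c star, of "\<lambda>m. - X m" "- f" u "- L u"] \<open>L u < 0\<close>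
      by auto
    then show ?thesis using tight_pair_minus by fastforce
  qed
qed

section \<open>Isometric copies of the sequence space\<close>

lift_definition ell1_unit :: "nat \<Rightarrow> ell1" is "\<lambda>i n. if n = i then 1 else 0"
proof -
  fix i :: nat
  show "summable (\<lambda>n. \<bar>if n = i then 1 else 0 :: real\<bar>)"
    by (rule summable_finite[of "{i}"]) auto
qed

lemma norm_ell1_units:
  assumes "i \<noteq> j"
  shows "norm (a *\<^sub>R ell1_unit i + b *\<^sub>R ell1_unit j) = \<bar>a\<bar> + \<bar>b\<bar>"
  using assms
proof transfer
  fix i j :: nat and a b :: real
  assume ij: "i \<noteq> j"
  have "(\<Sum>n. \<bar>a * (if n = i then 1 else 0) + b * (if n = j then 1 else 0)\<bar>)
    = (\<Sum>n\<in>{i, j}. \<bar>a * (if n = i then 1 else 0) + b * (if n = j then 1 else 0)\<bar>)"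
    by (rule suminf_finite) auto
  then show "(\<Sum>n. \<bar>a * (if n = i then 1 else 0) + b * (if n = j then 1 else 0)\<bar>) = \<bar>a\<bar> + \<bar>b\<bar>"
    using ij by simp
qed

text \<open>
  \<open>star\<close> provides the tight pairs, \<open>strict\<close> forces the pairs of different unit vectors apart, and
  \<open>rematch\<close> says that no minimum weight matching contains a given pair together with a pair far away.
\<close>

theorem no_isometric_copy_of_ell1:
  fixes x0 :: "'a::metric_space"
  assumes c: "c > 0" and star: "\<And>x y::'a. x \<noteq> y \<Longrightarrow> c * (2 + dist x x0 + dist y x0) \<le> dist x y"
    and strict: "\<And>x y z::'a. x \<noteq> y \<Longrightarrow> x \<noteq> z \<Longrightarrow> y \<noteq> z \<Longrightarrow> dist y z < dist x y + dist x z"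
    and rematch: "\<And>x y::'a. x \<noteq> y \<Longrightarrow> \<exists>F. finite F \<and> (\<forall>x' y'. x' \<notin> F \<longrightarrow> y' \<notin> F \<longrightarrow> x' \<noteq> y' \<longrightarrow>
      dist x y' + dist x' y < dist x y + dist x' y' \<or> dist x x' + dist y y' < dist x y + dist x' y')"
  shows "\<nexists>T :: ell1 \<Rightarrow> 'a tc. linear_isometric_embedding T"
proof
  assume "\<exists>T :: ell1 \<Rightarrow> 'a tc. linear_isometric_embedding T"
  then obtain T :: "ell1 \<Rightarrow> 'a tc" where T: "linear T" "\<And>x. norm (T x) = norm x"
    unfolding linear_isometric_embedding_def by blast
  define f where "f i = T (ell1_unit i)" for i
  have norm_f: "norm (a *\<^sub>R f i + b *\<^sub>R f j) = \<bar>a\<bar> + \<bar>b\<bar>" if "i \<noteq> j" for a b i j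
    using norm_ell1_units[OF that, of a b] T(2)[of "a *\<^sub>R ell1_unit i + b *\<^sub>R ell1_unit j"]
    by (simp add: f_def linear_add[OF T(1)] linear_scale[OF T(1)])
  have unit: "norm (f i) = 1" for i
    using norm_f[of i "Suc i" 1 0] by simp
  have plus: "norm (f i + f j) = norm (f i) + norm (f j)" if "i \<noteq> j" for i j
    using norm_f[OF that, of 1 1] unit by simp
  have minus: "norm (f i + - f j) = norm (f i) + norm (- f j)" if "i \<noteq> j" for i j
    using norm_f[OF that, of 1 "-1"] unit by simp
  have "\<exists>x y. tight_pair (f i) x y" for i
    using tight_pair_exists[OF c star, of "f i"] unit[of i] by fastforce
  then obtain x y where xy: "\<And>i. tight_pair (f i) (x i) (y i)" by metis
  have ne: "x i \<noteq> y i" for i using xy[of i] by (simp add: tight_pair_def)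
  have cross: "dist (x i) (y i) + dist (x j) (y j) \<le> dist (x i) (y j) + dist (x j) (y i)"
    "dist (x i) (y i) + dist (x j) (y j) \<le> dist (x i) (x j) + dist (y i) (y j)" if "i \<noteq> j" for i j
    using tight_pairs_cross[OF xy xy plus[OF that]]
      tight_pairs_cross[OF xy tight_pair_minus[OF xy] minus[OF that]]
    by (simp_all add: dist_commute)
  have strict': "dist q r < dist p q + dist p r" if "p \<noteq> q" "p \<noteq> r" for p q r :: 'a
    using that strict[of p q r] by (cases "q = r") auto
  have inj: "x i \<noteq> x j" "y i \<noteq> y j" if "i \<noteq> j" for i j
  proof -
    show "x i \<noteq> x j"
    proof
      assume "x i = x j"
      with cross(2)[OF that] strict'[of "x i" "y i" "y j"] ne[of i] ne[of j] show False by simp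
    qed
    show "y i \<noteq> y j"
    proof
      assume eq: "y i = y j"
      from strict'[of "y i" "x i" "x j"] ne[of i] ne[of j]
      have "dist (x i) (x j) < dist (x i) (y i) + dist (x j) (y j)"
        by (metis eq dist_commute)
      with cross(2)[OF that] show False by (simp add: eq)
    qed
  qed
  obtain F where F: "finite F" "\<And>x' y'. x' \<notin> F \<Longrightarrow> y' \<notin> F \<Longrightarrow> x' \<noteq> y' \<Longrightarrow>
      dist (x 0) y' + dist x' (y 0) < dist (x 0) (y 0) + dist x' y' \<or>
      dist (x 0) x' + dist (y 0) y' < dist (x 0) (y 0) + dist x' y'"
    using rematch[OF ne[of 0]] by blast
  have "inj x" "inj y" using inj by (meson injI)+
  then have "finite (x -` F \<union> y -` F \<union> {0})" using F(1) by (simp add: finite_vimageI)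
  from ex_new_if_finite[OF infinite_UNIV_nat this] obtain i where "i \<notin> x -` F \<union> y -` F \<union> {0}" ..
  then have "x i \<notin> F" "y i \<notin> F" "0 \<noteq> i" by auto
  from F(2)[OF this(1,2) ne] cross[OF this(3)] show False by linarith
qed

section \<open>Metrics of the form \<open>\<alpha>(k) + \<beta>(n)\<close>\<close>

text \<open>
  For three points with indices \<open>p < q < r\<close>, the conditions \<open>low\<close>, \<open>mid\<close>, \<open>high\<close> are the strict
  triangle inequality through the point with the lowest, middle and highest index, respectively; in
  each case the remaining terms cancel. Monotonicity of \<open>\<alpha> - \<beta>\<close> is the rematching inequality.
\<close>

theorem no_isometric_copy_of_ell1_split_metric:
  fixes v :: "nat \<Rightarrow> 'a::metric_space" and \<alpha> \<beta> :: "nat \<Rightarrow> real"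
  assumes v: "bij_betw v {1..} (UNIV :: 'a set)"
    and d: "\<And>k n. 1 \<le> k \<Longrightarrow> k < n \<Longrightarrow> dist (v k) (v n) = \<alpha> k + \<beta> n"
    and incr: "\<And>k n. 1 \<le> k \<Longrightarrow> k < n \<Longrightarrow> \<alpha> k - \<beta> k < \<alpha> n - \<beta> n"
    and low: "\<And>k n. 1 \<le> k \<Longrightarrow> k < n \<Longrightarrow> \<alpha> n - \<beta> n < 2 * \<alpha> k"
    and mid: "\<And>n. 1 \<le> n \<Longrightarrow> 0 < \<alpha> n + \<beta> n"
    and high: "\<And>n m. 1 \<le> n \<Longrightarrow> n < m \<Longrightarrow> \<beta> n - \<alpha> n < 2 * \<beta> m"
    and c: "c > 0"
    and star: "\<And>k n. 1 \<le> k \<Longrightarrow> k < n \<Longrightarrow>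
      c * (2 + dist (v k) (v 1) + dist (v n) (v 1)) \<le> \<alpha> k + \<beta> n"
  shows "\<nexists>T :: ell1 \<Rightarrow> 'a tc. linear_isometric_embedding T"
proof (rule no_isometric_copy_of_ell1[OF c])
  have index: "\<exists>i\<ge>1. x = v i" for x
    using v unfolding bij_betw_def by (metis UNIV_I atLeast_iff imageE)
  have star_lt: "c * (2 + dist (v i) (v 1) + dist (v j) (v 1)) \<le> dist (v i) (v j)"
    if "1 \<le> i" "i < j" for i j
    using star[OF that] d[OF that] by simp
  have strict_lt: "dist (v j) (v k) < dist (v i) (v j) + dist (v i) (v k)"
    if ijk: "1 \<le> i" "1 \<le> j" "j < k" "i \<noteq> j" "i \<noteq> k" for i j k
  proof -
    consider "i < j" | "j < i" "i < k" | "k < i" using ijk by linarith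
    then show ?thesis
    proof cases
      case 1
      then show ?thesis using ijk low[of i j] d[of j k] d[of i j] d[of i k] by simp
    next
      case 2
      then show ?thesis
        using ijk mid[of i] d[of j k] d[of j i] d[of i k] by (simp add: dist_commute[of "v i" "v j"])
    next
      case 3
      then show ?thesis using ijk high[of k i] d[of j k] d[of j i] d[of k i]
        by (simp add: dist_commute[of "v i" "v j"] dist_commute[of "v i" "v k"])
    qed
  qed
  have rematch_lt: "dist (v i) (v l) + dist (v j) (v k) < dist (v i) (v j) + dist (v k) (v l)"
    if "1 \<le> i" "i < j" "j < k" "k < l" for i j k l
    using that incr[of j k] d[of i l] d[of j k] d[of i j] d[of k l] by simp
  fix x y :: 'a
  assume "x \<noteq> y"
  obtain i j where ij: "i \<ge> 1" "j \<ge> 1" "x = v i" "y = v j" using index by metis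
  have "i < j \<or> j < i" using ij \<open>x \<noteq> y\<close> by (metis linorder_neqE_nat)
  then show "c * (2 + dist x (v 1) + dist y (v 1)) \<le> dist x y"
    using star_lt[of i j] star_lt[of j i] ij by (auto simp: dist_commute add.commute add.left_commute)
  show "dist y z < dist x y + dist x z" if "x \<noteq> z" "y \<noteq> z" for z
  proof -
    obtain k where k: "k \<ge> 1" "z = v k" using index by metis
    have "i \<noteq> j" "i \<noteq> k" "j \<noteq> k" using \<open>x \<noteq> y\<close> that k ij by auto
    then show ?thesis
      using strict_lt[of i j k] strict_lt[of i k j] ij k
      by (cases j k rule: linorder_cases) (simp_all add: dist_commute add.commute)
  qed
  show "\<exists>F. finite F \<and> (\<forall>x' y'. x' \<notin> F \<longrightarrow> y' \<notin> F \<longrightarrow> x' \<noteq> y' \<longrightarrow>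
      dist x y' + dist x' y < dist x y + dist x' y' \<or> dist x x' + dist y y' < dist x y + dist x' y')"
  proof (intro exI[of _ "v ` {..max i j}"] conjI allI impI)
    fix x' y' assume F: "x' \<notin> v ` {..max i j}" "y' \<notin> v ` {..max i j}" "x' \<noteq> y'"
    obtain k l where kl: "x' = v k" "y' = v l" using index by metis
    have "\<not> k \<le> max i j" "\<not> l \<le> max i j" "k < l \<or> l < k"
      using F kl by (auto simp: neq_iff[symmetric])
    then show "dist x y' + dist x' y < dist x y + dist x' y' \<or> dist x x' + dist y y' < dist x y + dist x' y'"
      using \<open>i < j \<or> j < i\<close> ij kl rematch_lt[of i j k l] rematch_lt[of i j l k]
        rematch_lt[of j i k l] rematch_lt[of j i l k]
      by (elim disjE) (simp_all add: dist_commute add.commute)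
  qed simp
qed

section \<open>The five metrics\<close>

theorem mainTheorem3:
  fixes v :: "nat \<Rightarrow> 'a::metric_space"
  assumes "bij_betw v {1..} (UNIV :: 'a set)"
    and "(\<forall>k\<ge>1. \<forall>n>k. dist (v k) (v n) = real k + real n - 1 / real k) \<or>
         (\<forall>k\<ge>1. \<forall>n>k. dist (v k) (v n) = 2 - 1 / real k + 1 / real n) \<or>
         (\<forall>k\<ge>1. \<forall>n>k. dist (v k) (v n) = 2 - 1 / real k - 1 / (2 * real n)) \<or>
         (\<forall>k\<ge>1. \<forall>n>k. dist (v k) (v n) = 1 + 1 / real n) \<or>
         (\<forall>k\<ge>1. \<forall>n>k. dist (v k) (v n) = 1 + 1 / (2 * real k) + 1 / real n)"
  shows "\<nexists>T :: ell1 \<Rightarrow> 'a tc. linear_isometric_embedding T"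
proof -
  \<comment> \<open>Metrics (b)--(e) are \<open>A + B r(k) + C r(n)\<close> with integer coefficients, where \<open>r(n) = 1 / (2 n)\<close>.\<close>
  define r where "r n = 1 / (2 * real n)" for n
  have lt: "r n < r k" if "1 \<le> k" "k < n" for k n
    unfolding r_def using that by (intro divide_strict_left_mono) auto
  have le: "r k \<le> 1 / 2" for k
    unfolding r_def by (cases "k = 0") (auto simp: field_simps)
  have pos: "0 < r k" if "1 \<le> k" for k
    unfolding r_def using that by simp
  have r: "1 / real k = 2 * r k" for k
    unfolding r_def by simp
  have bounded: ?thesis
    if d: "\<And>k n. 1 \<le> k \<Longrightarrow> k < n \<Longrightarrow> dist (v k) (v n) = A + B * r k + C * r n"
      and ABC: "A = 2 \<and> B = -2 \<and> C = 2 \<or> A = 2 \<and> B = -2 \<and> C = -1 \<or>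
        A = 1 \<and> B = 0 \<and> C = 2 \<or> A = 1 \<and> B = 1 \<and> C = 2" for A B C
  proof (rule no_isometric_copy_of_ell1_split_metric[OF assms(1),
          where \<alpha> = "\<lambda>k. A + B * r k" and \<beta> = "\<lambda>n. C * r n" and c = "1/12"])
    show "0 < A + B * r n + C * r n" if "1 \<le> n" for n
      using ABC pos[OF that] le[of n] by auto
    fix k n :: nat assume kn: "1 \<le> k" "k < n"
    have n: "1 \<le> n" using kn by simp
    note ineqs = pos[OF n] lt[OF kn] le[of k]
    show "dist (v k) (v n) = A + B * r k + C * r n" by (rule d[OF kn])
    show "A + B * r k - C * r k < A + B * r n - C * r n"
      using ABC ineqs by auto
    show "A + B * r n - C * r n < 2 * (A + B * r k)"
      using ABC ineqs by auto
    show "C * r k - (A + B * r k) < 2 * (C * r n)"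
      using ABC ineqs by auto
    \<comment> \<open>Distances lie between \<open>1/2\<close> and \<open>2\<close>, so the star condition holds with \<open>c = (1/2) / (2 + 2 + 2)\<close>.\<close>
    have "dist (v m) (v 1) \<le> 2" if "1 \<le> m" for m
    proof (cases "m = 1")
      case False
      then have m: "1 < m" using that by simp
      have "r 1 = 1 / 2" "r m \<le> 1 / 4"
        unfolding r_def using m by (auto simp: field_simps)
      then have "A + B * r 1 + C * r m \<le> 2"
        using ABC pos[OF that] by auto
      then show ?thesis using d[OF _ m] by (simp add: dist_commute)
    qed simp
    from this[OF kn(1)] this[OF n]
    have "(1/12) * (2 + dist (v k) (v 1) + dist (v n) (v 1)) \<le> 1/2" by simp
    also have "1/2 \<le> A + B * r k + C * r n"
      using ABC ineqs by auto
    finally show "(1/12) * (2 + dist (v k) (v 1) + dist (v n) (v 1)) \<le> A + B * r k + C * r n" .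
  qed simp
  from assms(2) show ?thesis
  proof (elim disjE)
    assume d: "\<forall>k\<ge>1. \<forall>n>k. dist (v k) (v n) = real k + real n - 1 / real k"
    show ?thesis
    proof (rule no_isometric_copy_of_ell1_split_metric[OF assms(1),
          where \<alpha> = "\<lambda>k. real k - 2 * r k" and \<beta> = real and c = "1/12"])
      show "0 < real n - 2 * r n + real n" if "1 \<le> n" for n
        using that le[of n] by simp
      fix k n :: nat assume kn: "1 \<le> k" "k < n"
      have n: "1 \<le> n" using kn by simp
      have ineqs: "r n < r k" "r k \<le> 1/2" "0 < r n" "1 \<le> real k" "real k + 1 \<le> real n"
        using lt[OF kn] le[of k] pos[OF n] kn by simp_all
      show "dist (v k) (v n) = real k - 2 * r k + real n" using d kn by (simp add: r)
      show "real k - 2 * r k - real k < real n - 2 * r n - real n" using ineqs by simp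
      show "real n - 2 * r n - real n < 2 * (real k - 2 * r k)" using ineqs by simp
      show "real k - (real k - 2 * r k) < 2 * real n" using ineqs by simp
      have "dist (v m) (v 1) \<le> real m" if "1 \<le> m" for m
        using that d by (cases "m = 1") (auto simp: dist_commute[of "v m"])
      from this[OF kn(1)] this[OF n]
      show "(1/12) * (2 + dist (v k) (v 1) + dist (v n) (v 1)) \<le> real k - 2 * r k + real n"
        using ineqs by simp
    qed simp
  next
    assume "\<forall>k\<ge>1. \<forall>n>k. dist (v k) (v n) = 2 - 1 / real k + 1 / real n"
    then show ?thesis by (intro bounded[of 2 "-2" 2]) (auto simp: r)
  next
    assume "\<forall>k\<ge>1. \<forall>n>k. dist (v k) (v n) = 2 - 1 / real k - 1 / (2 * real n)"
    then show ?thesis by (intro bounded[of 2 "-2" "-1"]) (auto simp: r r_def[symmetric])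
  next
    assume "\<forall>k\<ge>1. \<forall>n>k. dist (v k) (v n) = 1 + 1 / real n"
    then show ?thesis by (intro bounded[of 1 0 2]) (auto simp: r)
  next
    assume "\<forall>k\<ge>1. \<forall>n>k. dist (v k) (v n) = 1 + 1 / (2 * real k) + 1 / real n"
    then show ?thesis by (intro bounded[of 1 1 2]) (auto simp: r r_def[symmetric])
  qed
qed

end
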